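(* Let $\mathbf{k}$ be a field, let $\phi:B\to B'$ and $\phi':B'\to B''$ be morphisms of $\mathbf{k}$-bialgebras, let $E$, $E'$, $E''$ be right comodule algebras over $B$, $B'$, $B''$ respectively, let $f:E\to E'$ be a map of comodule algebras over $\phi$ and $g:E'\to E''$ a map of comodule algebras over $\phi'$. Then the 2-cells $\alpha$ paste correctly with respect to composition of comodule algebra maps over varying base: for all $M\in{}_E\mathcal{M}$ and $Q\in{}_B\mathcal{M}$, $$\alpha^{g,\phi'}_{f^*M,\phi^*Q}\circ g^*\bigl(\alpha^{f,\phi}_{M,Q}\bigr)=\alpha^{gf,\phi'\phi}_{M,Q},$$ up to the canonical isomorphisms $g^*f^*\cong(gf)^*$ and $\phi'^*\phi^*\cong(\phi'\phi)^*$. In particular, for the components at $B$, regarded as natural transformations $\alpha_B^{f,\phi}:f^*G_E\Rightarrow G_{E'}f^*$, $\alpha_{B'}^{g,\phi'}:g^*G_{E'}\Rightarrow G_{E''}g^*$ and $\alpha_B^{gf,\phi'\phi}:(gf)^*G_E\Rightarrow G_{E''}(gf)^*$, $$(\alpha_{B'}^{g,\phi'}f^* )\circ(g^*\alpha_B^{f,\phi})=\alpha_B^{gf,\phi'\phi},$$ up to the canonical isomorphism $g^*f^*\cong(gf)^*$.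
   Context: Algebras are associative and unital; unadorned $\otimes$ is over $\mathbf{k}$. ${}_R\mathcal{M}$ denotes the category of left $R$-modules. A right $B$-comodule algebra is an algebra $E$ with a right $B$-coaction $\rho:E\to E\otimes B$ that is an algebra map; write $\rho(e)=\sum e_{(0)}\otimes e_{(1)}$. If $(E,\rho)$ is a right $B$-comodule algebra and $(E',\rho')$ a right $B'$-comodule algebra, a map of comodule algebras over a bialgebra map $\phi:B\to B'$ is an algebra map $f:E\to E'$ with $\rho'\circ f=(f\otimes\phi)\circ\rho$. For an algebra map $f:A\to A'$, $f^*M=A'\otimes_A M$ is extension of scalars. For such a pair $(f,\phi)$, $M\in{}_E\mathcal{M}$ and $Q\in{}_B\mathcal{M}$, the $E'$-module map $\alpha^{f,\phi}_{M,Q}:E'\otimes_E(M\otimes Q)\to(E'\otimes_E M)\otimes(B'\otimes_B Q)$ is $e'\otimes_E(m\otimes q)\mapsto\sum(e'_{(0)}\otimes_E m)\otimes(e'_{(1)}\otimes_B q)$, where $M\otimes Q$ has $E$-action $e(m\otimes q)=\sum e_{(0)}m\otimes e_{(1)}q$ and the target has the analogous $E'$-action. $G_E:{}_E\mathcal{M}\to{}_E\mathcal{M}$ is $G_EM=M\otimes B$ with $e(m\otimes b)=\sum e_{(0)}m\otimes e_{(1)}b$, and $G_{E'}$, $G_{E''}$ are defined similarly with $B'$, $B''$. At $Q=B$, identifying $B'\otimes_B B\cong B'$, $\alpha^{f,\phi}_{M,B}$ becomes the component at $M$ of $\alpha_B^{f,\phi}:f^*G_E\Rightarrow G_{E'}f^*$,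 namely $e'\otimes_E(m\otimes b)\mapsto\sum(e'_{(0)}\otimes_E m)\otimes e'_{(1)}\phi(b)$; similarly for $\alpha_{B'}^{g,\phi'}$ and $\alpha_B^{gf,\phi'\phi}$. *)

theory Defs
  imports "HOL-Algebra.Module" "HOL-Algebra.Generated_Groups" "HOL-Algebra.Free_Abelian_Groups"
begin

section \<open>Modules over noncommutative rings\<close>

text \<open>The library locale \<open>module\<close> requires a commutative ring of scalars.
  As there, the ring multiplication stored in a module record is irrelevant.\<close>

locale left_module = R?: ring R + M?: abelian_group M
  for R :: "('r, 'c) ring_scheme" (structure) and M :: "('r, 'm, 'd) module_scheme" (structure) +
  assumes lsmult_closed:
      "\<lbrakk>a \<in> carrier R; x \<in> carrier M\<rbrakk> \<Longrightarrow> a \<odot>\<^bsub>M\<^esub> x \<in> carrier M"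
    and lsmult_l_distr:
      "\<lbrakk>a \<in> carrier R; b \<in> carrier R; x \<in> carrier M\<rbrakk>
        \<Longrightarrow> (a \<oplus> b) \<odot>\<^bsub>M\<^esub> x = a \<odot>\<^bsub>M\<^esub> x \<oplus>\<^bsub>M\<^esub> b \<odot>\<^bsub>M\<^esub> x"
    and lsmult_r_distr:
      "\<lbrakk>a \<in> carrier R; x \<in> carrier M; y \<in> carrier M\<rbrakk>
        \<Longrightarrow> a \<odot>\<^bsub>M\<^esub> (x \<oplus>\<^bsub>M\<^esub> y) = a \<odot>\<^bsub>M\<^esub> x \<oplus>\<^bsub>M\<^esub> a \<odot>\<^bsub>M\<^esub> y"
    and lsmult_assoc:
      "\<lbrakk>a \<in> carrier R; b \<in> carrier R; x \<in> carrier M\<rbrakk>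
        \<Longrightarrow> (a \<otimes> b) \<odot>\<^bsub>M\<^esub> x = a \<odot>\<^bsub>M\<^esub> (b \<odot>\<^bsub>M\<^esub> x)"
    and lsmult_one: "x \<in> carrier M \<Longrightarrow> \<one> \<odot>\<^bsub>M\<^esub> x = x"

definition lmod_hom ::
  "('r, 'c) ring_scheme \<Rightarrow> ('r, 'm, 'd) module_scheme \<Rightarrow> ('r, 'n, 'e) module_scheme \<Rightarrow> ('m \<Rightarrow> 'n) set"
  where "lmod_hom R M N =
    {h \<in> hom (add_monoid M) (add_monoid N).
       \<forall>r \<in> carrier R. \<forall>m \<in> carrier M. h (r \<odot>\<^bsub>M\<^esub> m) = r \<odot>\<^bsub>N\<^esub> h m}"

definition lmod_iso ::
  "('r, 'c) ring_scheme \<Rightarrow> ('r, 'm, 'd) module_scheme \<Rightarrow> ('r, 'n, 'e) module_scheme \<Rightarrow> ('m \<Rightarrow> 'n) set"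
  where "lmod_iso R M N = {h \<in> lmod_hom R M N. bij_betw h (carrier M) (carrier N)}"

definition as_module :: "('a, 'c) ring_scheme \<Rightarrow> ('r \<Rightarrow> 'a \<Rightarrow> 'a) \<Rightarrow> ('r, 'a) module"
  where "as_module A s =
    \<lparr>carrier = carrier A, monoid.mult = monoid.mult A, one = \<one>\<^bsub>A\<^esub>,
     ring.zero = \<zero>\<^bsub>A\<^esub>, ring.add = add A, module.smult = s\<rparr>"

definition regular_module :: "('a, 'c) ring_scheme \<Rightarrow> ('a, 'a) module"
  where "regular_module A = as_module A (monoid.mult A)"


section \<open>Tensor products over a ring\<close>

text \<open>\<open>X\<close> is a right \<open>R\<close>-module, its action \<open>xr\<close> being passed separately, and \<open>Y\<close> is a left
  \<open>R\<close>-module. Their tensor product is the free abelian group on pairs modulo the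
  usual relations, so that its elements are cosets.\<close>

type_synonym ('x, 'y) tensor = "(('x \<times> 'y) \<Rightarrow>\<^sub>0 int) set"

definition tensor_relators ::
  "('r, 'c) ring_scheme \<Rightarrow> ('x, 'd) ring_scheme \<Rightarrow> ('x \<Rightarrow> 'r \<Rightarrow> 'x) \<Rightarrow>
   ('r, 'y, 'e) module_scheme \<Rightarrow> ('x, 'y) tensor"
  where "tensor_relators R X xr Y =
    {frag_of (x \<oplus>\<^bsub>X\<^esub> x', y) - frag_of (x, y) - frag_of (x', y) | x x' y.
       x \<in> carrier X \<and> x' \<in> carrier X \<and> y \<in> carrier Y} \<union>
    {frag_of (x, y \<oplus>\<^bsub>Y\<^esub> y') - frag_of (x, y) - frag_of (x, y') | x y y'.
       x \<in> carrier X \<and> y \<in> carrier Y \<and> y' \<in> carrier Y} \<union>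
    {frag_of (xr x r, y) - frag_of (x, r \<odot>\<^bsub>Y\<^esub> y) | x r y.
       x \<in> carrier X \<and> r \<in> carrier R \<and> y \<in> carrier Y}"

definition tensor_null ::
  "('r, 'c) ring_scheme \<Rightarrow> ('x, 'd) ring_scheme \<Rightarrow> ('x \<Rightarrow> 'r \<Rightarrow> 'x) \<Rightarrow>
   ('r, 'y, 'e) module_scheme \<Rightarrow> ('x, 'y) tensor"
  where "tensor_null R X xr Y =
    generate (free_Abelian_group (carrier X \<times> carrier Y)) (tensor_relators R X xr Y)"

definition tensor_group ::
  "('r, 'c) ring_scheme \<Rightarrow> ('x, 'd) ring_scheme \<Rightarrow> ('x \<Rightarrow> 'r \<Rightarrow> 'x) \<Rightarrow>
   ('r, 'y, 'e) module_scheme \<Rightarrow> ('x, 'y) tensor monoid"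
  where "tensor_group R X xr Y =
    free_Abelian_group (carrier X \<times> carrier Y) Mod tensor_null R X xr Y"

text \<open>The same group written additively; its multiplication is a placeholder.\<close>

definition tensor ::
  "('r, 'c) ring_scheme \<Rightarrow> ('x, 'd) ring_scheme \<Rightarrow> ('x \<Rightarrow> 'r \<Rightarrow> 'x) \<Rightarrow>
   ('r, 'y, 'e) module_scheme \<Rightarrow> ('x, 'y) tensor ring"
  where "tensor R X xr Y =
    \<lparr>carrier = carrier (tensor_group R X xr Y), monoid.mult = undefined, one = undefined,
     ring.zero = \<one>\<^bsub>tensor_group R X xr Y\<^esub>, ring.add = monoid.mult (tensor_group R X xr Y)\<rparr>"

definition tpure ::
  "('r, 'c) ring_scheme \<Rightarrow> ('x, 'd) ring_scheme \<Rightarrow> ('x \<Rightarrow> 'r \<Rightarrow> 'x) \<Rightarrow>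
   ('r, 'y, 'e) module_scheme \<Rightarrow> 'x \<Rightarrow> 'y \<Rightarrow> ('x, 'y) tensor"
  where "tpure R X xr Y x y =
    tensor_null R X xr Y #>\<^bsub>free_Abelian_group (carrier X \<times> carrier Y)\<^esub> frag_of (x, y)"

text \<open>The additive map to \<open>Z\<close> induced by a balanced biadditive map \<open>\<beta>\<close>: writing a tensor
  \<open>t\<close> as a sum of pure tensors \<open>x \<otimes> y\<close>, the value \<open>tlift Z \<beta> t\<close> is the sum of the
  \<open>\<beta> x y\<close>. In particular \<open>tlift Z \<beta> (\<rho> e)\<close> is the Sweedler sum of the \<open>\<beta> e\<^sub>0 e\<^sub>1\<close>.\<close>

definition free_lift :: "('z, 'c) ring_scheme \<Rightarrow> ('x \<Rightarrow> 'y \<Rightarrow> 'z) \<Rightarrow> (('x \<times> 'y) \<Rightarrow>\<^sub>0 int) \<Rightarrow> 'z"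
  where "free_lift Z \<beta> a =
    (\<Oplus>\<^bsub>Z\<^esub>p \<in> Poly_Mapping.keys a. add_pow Z (Poly_Mapping.lookup a p) (\<beta> (fst p) (snd p)))"

definition tlift :: "('z, 'c) ring_scheme \<Rightarrow> ('x \<Rightarrow> 'y \<Rightarrow> 'z) \<Rightarrow> ('x, 'y) tensor \<Rightarrow> 'z"
  where "tlift Z \<beta> t = the_elem (free_lift Z \<beta> ` t)"

lemma free_lift_hom:
  fixes Z :: "('z,'c) ring_scheme" and S :: "('x \<times> 'y) set"
  assumes Z: "abelian_group Z" and b: "\<And>p. p \<in> S \<Longrightarrow> \<beta> (fst p) (snd p) \<in> carrier Z"
  shows "free_lift Z \<beta> \<in> hom (free_Abelian_group S) (add_monoid Z)"
    and "p \<in> S \<Longrightarrow> free_lift Z \<beta> (frag_of p) = \<beta> (fst p) (snd p)"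
proof -
  interpret Z: abelian_group Z by fact
  define f where "f = (\<lambda>p. \<beta> (fst p) (snd p))"
  have f: "f p \<in> carrier Z" if "p \<in> S" for p using b that by (simp add: f_def)
  let ?P = "\<lambda>a :: _ \<Rightarrow>\<^sub>0 int. \<lambda>p. add_pow Z (Poly_Mapping.lookup a p) (f p)"
  have cl: "add_pow Z (n::int) (f p) \<in> carrier Z" if "p \<in> S" for n p
    using Z.add.int_pow_closed[of "f p" n] f that by simp
  have ext: "free_lift Z \<beta> a = finsum Z (?P a) T" if "Poly_Mapping.keys a \<subseteq> T" "T \<subseteq> S" "finite T" for a T
  proof -
    have z: "add_pow Z (0::int) (f p) = \<zero>\<^bsub>Z\<^esub>" for p by (simp add: add_pow_def)
    have "finsum Z (?P a) (Poly_Mapping.keys a) = finsum Z (?P a) T"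
      by (rule Z.add.finprod_mono_neutral_cong_left)
         (use that cl z in \<open>auto simp: in_keys_iff\<close>)
    then show ?thesis by (simp add: free_lift_def f_def)
  qed
  show "free_lift Z \<beta> \<in> hom (free_Abelian_group S) (add_monoid Z)"
  proof (rule homI)
    fix a assume "a \<in> carrier (free_Abelian_group S)"
    then have "free_lift Z \<beta> a = finsum Z (?P a) (Poly_Mapping.keys a)" using ext[of a "Poly_Mapping.keys a"] by simp
    also have "\<dots> \<in> carrier Z" using \<open>a \<in> _\<close> by (intro Z.finsum_closed) (use cl in auto)
    finally show "free_lift Z \<beta> a \<in> carrier (add_monoid Z)" by simp
  next
    fix a a' assume a: "a \<in> carrier (free_Abelian_group S)" "a' \<in> carrier (free_Abelian_group S)"
    let ?T = "Poly_Mapping.keys a \<union> Poly_Mapping.keys a'"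
    have T: "?T \<subseteq> S" "finite ?T" using a by auto
    have k: "Poly_Mapping.keys (a + a') \<subseteq> ?T" by (rule keys_add)
    have "free_lift Z \<beta> (a + a') = finsum Z (?P (a+a')) ?T" by (rule ext[OF k T])
    also have "\<dots> = finsum Z (\<lambda>p. ?P a p \<oplus>\<^bsub>Z\<^esub> ?P a' p) ?T"
    proof (rule Z.finsum_cong')
      fix p assume "p \<in> ?T"
      then have "p \<in> S" using T by auto
      then show "?P (a+a') p = ?P a p \<oplus>\<^bsub>Z\<^esub> ?P a' p"
        using Z.add.int_pow_mult[of "f p"] f by (simp add: Poly_Mapping.lookup_add)
    qed (use T cl in auto)
    also have "\<dots> = finsum Z (?P a) ?T \<oplus>\<^bsub>Z\<^esub> finsum Z (?P a') ?T"
      by (rule Z.finsum_addf) (use T cl in auto)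
    finally show "free_lift Z \<beta> (a \<otimes>\<^bsub>free_Abelian_group S\<^esub> a') = free_lift Z \<beta> a \<otimes>\<^bsub>add_monoid Z\<^esub> free_lift Z \<beta> a'"
      using ext[of a ?T] ext[of a' ?T] T by simp
  qed
  show "free_lift Z \<beta> (frag_of p) = \<beta> (fst p) (snd p)" if "p \<in> S"
  proof -
    have "free_lift Z \<beta> (frag_of p) = finsum Z (?P (frag_of p)) {p}" using ext[of "frag_of p" "{p}"] that by simp
    also have "\<dots> = add_pow Z (1::int) (f p)" using cl[OF that] by (simp add: lookup_frag_of)
    also have "\<dots> = f p" using Z.add.int_pow_1[of "f p"] f[OF that] by simp
    finally show ?thesis by (simp add: f_def)
  qed
qed

lemma tlift_tpure:
  fixes X :: "('x, 'd) ring_scheme" and Y :: "('r, 'y, 'e) module_scheme" and Z :: "('z, 'g) ring_scheme"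
  assumes X: "abelian_group X" and Y: "abelian_group Y" and Z: "abelian_group Z"
    and xr: "\<And>x r. x \<in> carrier X \<Longrightarrow> r \<in> carrier R \<Longrightarrow> xr x r \<in> carrier X"
    and yl: "\<And>r y. r \<in> carrier R \<Longrightarrow> y \<in> carrier Y \<Longrightarrow> r \<odot>\<^bsub>Y\<^esub> y \<in> carrier Y"
    and \<beta>: "\<And>x y. x \<in> carrier X \<Longrightarrow> y \<in> carrier Y \<Longrightarrow> \<beta> x y \<in> carrier Z"
    and \<beta>1: "\<And>x x' y. x \<in> carrier X \<Longrightarrow> x' \<in> carrier X \<Longrightarrow> y \<in> carrier Y \<Longrightarrow>
             \<beta> (x \<oplus>\<^bsub>X\<^esub> x') y = \<beta> x y \<oplus>\<^bsub>Z\<^esub> \<beta> x' y"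
    and \<beta>2: "\<And>x y y'. x \<in> carrier X \<Longrightarrow> y \<in> carrier Y \<Longrightarrow> y' \<in> carrier Y \<Longrightarrow>
             \<beta> x (y \<oplus>\<^bsub>Y\<^esub> y') = \<beta> x y \<oplus>\<^bsub>Z\<^esub> \<beta> x y'"
    and \<beta>3: "\<And>x r y. x \<in> carrier X \<Longrightarrow> r \<in> carrier R \<Longrightarrow> y \<in> carrier Y \<Longrightarrow>
             \<beta> (xr x r) y = \<beta> x (r \<odot>\<^bsub>Y\<^esub> y)"
  shows "tlift Z \<beta> \<in> hom (add_monoid (tensor R X xr Y)) (add_monoid Z)"
    and "x \<in> carrier X \<Longrightarrow> y \<in> carrier Y \<Longrightarrow> tlift Z \<beta> (tpure R X xr Y x y) = \<beta> x y"
proof -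
  interpret X: abelian_group X by fact
  interpret Y: abelian_group Y by fact
  interpret Z: abelian_group Z by fact
  define S where "S = carrier X \<times> carrier Y"
  let ?F = "free_Abelian_group S"
  interpret F: comm_group ?F by (rule abelian_free_Abelian_group)
  have h: "free_lift Z \<beta> \<in> hom ?F (add_monoid Z)" by (rule free_lift_hom(1)) (use \<beta> Z in \<open>auto simp: S_def\<close>)
  have hp: "free_lift Z \<beta> (frag_of (x,y)) = \<beta> x y" if "x \<in> carrier X" "y \<in> carrier Y" for x y
    using free_lift_hom(2)[of Z S \<beta> "(x,y)"] that \<beta> Z by (auto simp: S_def)
  interpret h: group_hom ?F "add_monoid Z" "free_lift Z \<beta>"
    using h by (simp add: group_hom_def group_hom_axioms_def F.is_group Z.a_group)
  have sub: "tensor_relators R X xr Y \<subseteq> carrier ?F"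
    using xr yl by (auto simp: tensor_relators_def S_def dest!: subsetD[OF keys_diff])
  have diff: "free_lift Z \<beta> (a - b) = free_lift Z \<beta> a \<ominus>\<^bsub>Z\<^esub> free_lift Z \<beta> b"
    if "a \<in> carrier ?F" "b \<in> carrier ?F" for a b
  proof -
    have "free_lift Z \<beta> (a \<otimes>\<^bsub>?F\<^esub> inv\<^bsub>?F\<^esub> b) = free_lift Z \<beta> a \<otimes>\<^bsub>add_monoid Z\<^esub> inv\<^bsub>add_monoid Z\<^esub> (free_lift Z \<beta> b)"
      using that h.hom_mult h.hom_inv F.inv_closed by metis
    then show ?thesis using that by (simp add: a_minus_def a_inv_def)
  qed
  have kd: "a - b \<in> carrier ?F" if "a \<in> carrier ?F" "b \<in> carrier ?F" for a b
    using that keys_diff[of a b] by auto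
  have fo: "frag_of (x,y) \<in> carrier ?F" if "x \<in> carrier X" "y \<in> carrier Y" for x y
    using that by (simp add: S_def)
  have canc: "u \<oplus>\<^bsub>Z\<^esub> v \<ominus>\<^bsub>Z\<^esub> u \<ominus>\<^bsub>Z\<^esub> v = \<zero>\<^bsub>Z\<^esub>" if "u \<in> carrier Z" "v \<in> carrier Z" for u v
    using that by (simp add: Z.minus_eq Z.a_assoc Z.a_comm[of u] Z.r_neg Z.r_neg2)
  have ker: "free_lift Z \<beta> a = \<zero>\<^bsub>Z\<^esub>" if "a \<in> tensor_relators R X xr Y" for a
    using that unfolding tensor_relators_def
  proof (elim UnE CollectE exE conjE)
    fix x x' y assume [simp]: "a = frag_of (x \<oplus>\<^bsub>X\<^esub> x', y) - frag_of (x, y) - frag_of (x', y)"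
      "x \<in> carrier X" "x' \<in> carrier X" "y \<in> carrier Y"
    show ?thesis
      by (simp add: diff kd fo hp \<beta>1 \<beta> canc del: carrier_free_Abelian_group_iff frag_of_in_free_Abelian_group)
  next
    fix x y y' assume [simp]: "a = frag_of (x, y \<oplus>\<^bsub>Y\<^esub> y') - frag_of (x, y) - frag_of (x, y')"
      "x \<in> carrier X" "y \<in> carrier Y" "y' \<in> carrier Y"
    show ?thesis
      by (simp add: diff kd fo hp \<beta>2 \<beta> canc del: carrier_free_Abelian_group_iff frag_of_in_free_Abelian_group)
  next
    fix x r y assume [simp]: "a = frag_of (xr x r, y) - frag_of (x, r \<odot>\<^bsub>Y\<^esub> y)"
      "x \<in> carrier X" "r \<in> carrier R" "y \<in> carrier Y"
    show ?thesis
      by (simp add: diff kd fo hp \<beta>3 \<beta> xr yl Z.minus_eq Z.r_neg del: carrier_free_Abelian_group_iff frag_of_in_free_Abelian_group)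
  qed
  let ?N = "tensor_null R X xr Y"
  have Nk: "?N \<subseteq> kernel ?F (add_monoid Z) (free_lift Z \<beta>)"
    unfolding tensor_null_def S_def[symmetric]
    by (rule F.generate_subgroup_incl) (use ker sub h.subgroup_kernel in \<open>auto simp: kernel_def subset_iff\<close>)
  have Nsub: "subgroup ?N ?F" unfolding tensor_null_def S_def[symmetric]
    by (rule F.generate_is_subgroup[OF sub])
  then have N: "?N \<lhd> ?F" by (rule F.normal_iff_subgroup[THEN iffD2])
  interpret N: normal ?N ?F by (rule N)
  have val: "tlift Z \<beta> (?N #>\<^bsub>?F\<^esub> a) = free_lift Z \<beta> a" if a: "a \<in> carrier ?F" for a
  proof -
    have "free_lift Z \<beta> b = free_lift Z \<beta> a" if "b \<in> ?N #>\<^bsub>?F\<^esub> a" for b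
    proof -
      from that obtain n where n: "n \<in> ?N" and b: "b = n \<otimes>\<^bsub>?F\<^esub> a" unfolding r_coset_def by auto
      have "free_lift Z \<beta> n = \<zero>\<^bsub>Z\<^esub>" "n \<in> carrier ?F" using n Nk by (auto simp: kernel_def)
      then show ?thesis unfolding b using a h.hom_mult h.hom_closed by auto
    qed
    moreover have "a \<in> ?N #>\<^bsub>?F\<^esub> a" using F.rcos_self[OF a Nsub] .
    ultimately have "(free_lift Z \<beta>) ` (?N #>\<^bsub>?F\<^esub> a) = {free_lift Z \<beta> a}" by blast
    then show ?thesis unfolding tlift_def by simp
  qed
  show "x \<in> carrier X \<Longrightarrow> y \<in> carrier Y \<Longrightarrow> tlift Z \<beta> (tpure R X xr Y x y) = \<beta> x y"
    unfolding tpure_def S_def[symmetric] using val[OF fo] hp by simp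
  show "tlift Z \<beta> \<in> hom (add_monoid (tensor R X xr Y)) (add_monoid Z)"
  proof (rule homI)
    fix s assume "s \<in> carrier (add_monoid (tensor R X xr Y))"
    then show "tlift Z \<beta> s \<in> carrier (add_monoid Z)"
      using val h.hom_closed by (auto simp: tensor_def tensor_group_def S_def[symmetric] carrier_FactGroup simp del: carrier_free_Abelian_group_iff frag_of_in_free_Abelian_group)
  next
    fix s t assume "s \<in> carrier (add_monoid (tensor R X xr Y))" "t \<in> carrier (add_monoid (tensor R X xr Y))"
    then obtain a b where ab: "a \<in> carrier ?F" "b \<in> carrier ?F" "s = ?N #>\<^bsub>?F\<^esub> a" "t = ?N #>\<^bsub>?F\<^esub> b"
      by (auto simp: tensor_def tensor_group_def S_def[symmetric] carrier_FactGroup simp del: carrier_free_Abelian_group_iff frag_of_in_free_Abelian_group)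
    then have "s <#>\<^bsub>?F\<^esub> t = ?N #>\<^bsub>?F\<^esub> (a \<otimes>\<^bsub>?F\<^esub> b)" using N.rcos_sum by simp
    then show "tlift Z \<beta> (s \<otimes>\<^bsub>add_monoid (tensor R X xr Y)\<^esub> t) = tlift Z \<beta> s \<otimes>\<^bsub>add_monoid Z\<^esub> tlift Z \<beta> t"
      using ab val[OF F.m_closed[OF ab(1,2)]] val[OF ab(1)] val[OF ab(2)] h.hom_mult[OF ab(1,2)]
      by (simp add: tensor_def tensor_group_def S_def[symmetric] del: mult_free_Abelian_group)
  qed
qed

abbreviation ktensor ::
  "('k, 'c) ring_scheme \<Rightarrow> ('k, 'x, 'd) module_scheme \<Rightarrow> ('k, 'y, 'e) module_scheme \<Rightarrow>
   ('x, 'y) tensor ring"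
  where "ktensor K X Y \<equiv> tensor K X (\<lambda>x c. c \<odot>\<^bsub>X\<^esub> x) Y"

abbreviation kpure ::
  "('k, 'c) ring_scheme \<Rightarrow> ('k, 'x, 'd) module_scheme \<Rightarrow> ('k, 'y, 'e) module_scheme \<Rightarrow>
   'x \<Rightarrow> 'y \<Rightarrow> ('x, 'y) tensor"
  where "kpure K X Y \<equiv> tpure K X (\<lambda>x c. c \<odot>\<^bsub>X\<^esub> x) Y"


section \<open>Algebras, bialgebras and comodule algebras\<close>

text \<open>The library locale \<open>algebra\<close> is for commutative algebras.\<close>

locale assoc_algebra = module K A + ring A
  for K :: "('k, 'c) ring_scheme" (structure) and A :: "('k, 'a, 'd) module_scheme" (structure) +
  assumes asmult_left:
      "\<lbrakk>c \<in> carrier K; x \<in> carrier A; y \<in> carrier A\<rbrakk>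
        \<Longrightarrow> (c \<odot>\<^bsub>A\<^esub> x) \<otimes>\<^bsub>A\<^esub> y = c \<odot>\<^bsub>A\<^esub> (x \<otimes>\<^bsub>A\<^esub> y)"
    and asmult_right:
      "\<lbrakk>c \<in> carrier K; x \<in> carrier A; y \<in> carrier A\<rbrakk>
        \<Longrightarrow> x \<otimes>\<^bsub>A\<^esub> (c \<odot>\<^bsub>A\<^esub> y) = c \<odot>\<^bsub>A\<^esub> (x \<otimes>\<^bsub>A\<^esub> y)"

definition alg_hom ::
  "('k, 'c) ring_scheme \<Rightarrow> ('k, 'a, 'd) module_scheme \<Rightarrow> ('k, 'b, 'e) module_scheme \<Rightarrow> ('a \<Rightarrow> 'b) set"
  where "alg_hom K A B =
    {f \<in> ring_hom A B. \<forall>c \<in> carrier K. \<forall>a \<in> carrier A. f (c \<odot>\<^bsub>A\<^esub> a) = c \<odot>\<^bsub>B\<^esub> f a}"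

definition alg_tensor ::
  "('k, 'c) ring_scheme \<Rightarrow> ('k, 'a, 'd) module_scheme \<Rightarrow> ('k, 'b, 'e) module_scheme \<Rightarrow>
   ('k, ('a, 'b) tensor) module"
  where "alg_tensor K A B = (let T = ktensor K A B in
    \<lparr>carrier = carrier T,
     monoid.mult = (\<lambda>s t. tlift T (\<lambda>a b. tlift T (\<lambda>a' b'.
                     kpure K A B (a \<otimes>\<^bsub>A\<^esub> a') (b \<otimes>\<^bsub>B\<^esub> b')) t) s),
     one = kpure K A B \<one>\<^bsub>A\<^esub> \<one>\<^bsub>B\<^esub>,
     ring.zero = \<zero>\<^bsub>T\<^esub>, ring.add = add T,
     smult = (\<lambda>c. tlift T (\<lambda>a b. kpure K A B (c \<odot>\<^bsub>A\<^esub> a) b))\<rparr>)"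

record ('k, 'b) bialgebra = "('k, 'b) module" +
  comult :: "'b \<Rightarrow> ('b, 'b) tensor"
  counit :: "'b \<Rightarrow> 'k"

record ('k, 'e, 'b) comodule_algebra = "('k, 'e) module" +
  coact :: "'e \<Rightarrow> ('e, 'b) tensor"

locale bialgebra = assoc_algebra K B
  for K :: "('k, 'c) ring_scheme" (structure) and B :: "('k, 'b) bialgebra" (structure) +
  assumes comult_hom: "comult B \<in> alg_hom K B (alg_tensor K B B)"
    and counit_hom: "counit B \<in> ring_hom B K"
    and counit_smult:
      "\<lbrakk>c \<in> carrier K; b \<in> carrier B\<rbrakk> \<Longrightarrow> counit B (c \<odot>\<^bsub>B\<^esub> b) = c \<otimes>\<^bsub>K\<^esub> counit B b"
    and coassoc:
      "b \<in> carrier B \<Longrightarrow>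
        tlift (ktensor K B (alg_tensor K B B))
          (\<lambda>b1 b2. tlift (ktensor K B (alg_tensor K B B))
             (\<lambda>b11 b12. kpure K B (alg_tensor K B B) b11 (kpure K B B b12 b2)) (comult B b1))
          (comult B b) =
        tlift (ktensor K B (alg_tensor K B B))
          (\<lambda>b1 b2. kpure K B (alg_tensor K B B) b1 (comult B b2)) (comult B b)"
    and counit_left: "b \<in> carrier B \<Longrightarrow> tlift B (\<lambda>b1 b2. counit B b1 \<odot>\<^bsub>B\<^esub> b2) (comult B b) = b"
    and counit_right: "b \<in> carrier B \<Longrightarrow> tlift B (\<lambda>b1 b2. counit B b2 \<odot>\<^bsub>B\<^esub> b1) (comult B b) = b"

definition bialg_hom ::
  "('k, 'c) ring_scheme \<Rightarrow> ('k, 'a) bialgebra \<Rightarrow> ('k, 'b) bialgebra \<Rightarrow> ('a \<Rightarrow> 'b) set"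
  where "bialg_hom K A B =
    {\<phi> \<in> alg_hom K A B. \<forall>a \<in> carrier A.
       comult B (\<phi> a) = tlift (ktensor K B B) (\<lambda>a1 a2. kpure K B B (\<phi> a1) (\<phi> a2)) (comult A a) \<and>
       counit B (\<phi> a) = counit A a}"

locale comodule_algebra = B: bialgebra K B + E: assoc_algebra K E
  for K :: "('k, 'c) ring_scheme" (structure)
    and B :: "('k, 'b) bialgebra" and E :: "('k, 'e, 'b) comodule_algebra" +
  assumes coact_hom: "coact E \<in> alg_hom K E (alg_tensor K E B)"
    and coact_coassoc:
      "e \<in> carrier E \<Longrightarrow>
        tlift (ktensor K E (alg_tensor K B B))
          (\<lambda>e0 b. tlift (ktensor K E (alg_tensor K B B))
             (\<lambda>e00 e01. kpure K E (alg_tensor K B B) e00 (kpure K B B e01 b)) (coact E e0))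
          (coact E e) =
        tlift (ktensor K E (alg_tensor K B B))
          (\<lambda>e0 b. kpure K E (alg_tensor K B B) e0 (comult B b)) (coact E e)"
    and coact_counit: "e \<in> carrier E \<Longrightarrow> tlift E (\<lambda>e0 e1. counit B e1 \<odot>\<^bsub>E\<^esub> e0) (coact E e) = e"

definition comod_alg_hom ::
  "('k, 'c) ring_scheme \<Rightarrow> ('k, 'b') bialgebra \<Rightarrow> ('b \<Rightarrow> 'b') \<Rightarrow>
   ('k, 'e, 'b) comodule_algebra \<Rightarrow> ('k, 'e', 'b') comodule_algebra \<Rightarrow> ('e \<Rightarrow> 'e') set"
  where "comod_alg_hom K B' \<phi> E E' =
    {f \<in> alg_hom K E E'. \<forall>e \<in> carrier E.
       coact E' (f e) = tlift (ktensor K E' B') (\<lambda>e0 e1. kpure K E' B' (f e0) (\<phi> e1)) (coact E e)}"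


section \<open>Extension of scalars\<close>

abbreviation ext_tensor ::
  "('a, 'c) ring_scheme \<Rightarrow> ('a \<Rightarrow> 'a') \<Rightarrow> ('a', 'd) ring_scheme \<Rightarrow> ('a, 'm) module \<Rightarrow>
   ('a', 'm) tensor ring"
  where "ext_tensor A f A' M \<equiv> tensor A A' (\<lambda>a' a. a' \<otimes>\<^bsub>A'\<^esub> f a) M"

abbreviation ext_pure ::
  "('a, 'c) ring_scheme \<Rightarrow> ('a \<Rightarrow> 'a') \<Rightarrow> ('a', 'd) ring_scheme \<Rightarrow> ('a, 'm) module \<Rightarrow>
   'a' \<Rightarrow> 'm \<Rightarrow> ('a', 'm) tensor"
  where "ext_pure A f A' M \<equiv> tpure A A' (\<lambda>a' a. a' \<otimes>\<^bsub>A'\<^esub> f a) M"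

definition ext ::
  "('a, 'c) ring_scheme \<Rightarrow> ('a \<Rightarrow> 'a') \<Rightarrow> ('a', 'd) ring_scheme \<Rightarrow> ('a, 'm) module \<Rightarrow>
   ('a', ('a', 'm) tensor) module"
  where "ext A f A' M = (let T = ext_tensor A f A' M in
    as_module T (\<lambda>c. tlift T (\<lambda>a' m. ext_pure A f A' M (c \<otimes>\<^bsub>A'\<^esub> a') m)))"

definition ext_map ::
  "('a, 'c) ring_scheme \<Rightarrow> ('a \<Rightarrow> 'a') \<Rightarrow> ('a', 'd) ring_scheme \<Rightarrow> ('a, 'n) module \<Rightarrow>
   ('m \<Rightarrow> 'n) \<Rightarrow> ('a', 'm) tensor \<Rightarrow> ('a', 'n) tensor"
  where "ext_map A f A' N h =
    tlift (ext A f A' N) (\<lambda>a' m. ext_pure A f A' N a' (h m))"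

text \<open>The canonical map from \<open>g\<^sup>* f\<^sup>* M\<close> to \<open>(g f)\<^sup>* M\<close>, sending
  \<open>a'' \<otimes> (a' \<otimes> m)\<close> to \<open>a'' g(a') \<otimes> m\<close>.\<close>

definition can ::
  "('a, 'c) ring_scheme \<Rightarrow> ('a \<Rightarrow> 'a') \<Rightarrow> ('a' \<Rightarrow> 'a'') \<Rightarrow> ('a'', 'e) ring_scheme \<Rightarrow>
   ('a, 'm) module \<Rightarrow> ('a'', ('a', 'm) tensor) tensor \<Rightarrow> ('a'', 'm) tensor"
  where "can A f g A'' M = (let Z = ext A (g \<circ> f) A'' M in
    tlift Z (\<lambda>a'' t. tlift Z (\<lambda>a' m. ext_pure A (g \<circ> f) A'' M (a'' \<otimes>\<^bsub>A''\<^esub> g a') m) t))"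


section \<open>The diagonal action on a tensor product over the base field\<close>

text \<open>The \<open>K\<close>-module underlying a module over a \<open>K\<close>-algebra.\<close>

definition restrict_base ::
  "('k, 'a, 'd) module_scheme \<Rightarrow> ('a, 'm) module \<Rightarrow> ('k, 'm) module"
  where "restrict_base A M = as_module M (\<lambda>c m. (c \<odot>\<^bsub>A\<^esub> \<one>\<^bsub>A\<^esub>) \<odot>\<^bsub>M\<^esub> m)"

abbreviation mpure ::
  "('k, 'c) ring_scheme \<Rightarrow> ('k, 'b) bialgebra \<Rightarrow> ('k, 'e, 'b) comodule_algebra \<Rightarrow>
   ('e, 'm) module \<Rightarrow> ('b, 'q) module \<Rightarrow> 'm \<Rightarrow> 'q \<Rightarrow> ('m, 'q) tensor"
  where "mpure K B E M Q \<equiv> kpure K (restrict_base E M) (restrict_base B Q)"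

text \<open>The \<open>E\<close>-module \<open>M \<otimes> Q\<close> for an \<open>E\<close>-module \<open>M\<close> and a \<open>B\<close>-module \<open>Q\<close>.\<close>

definition mtensor ::
  "('k, 'c) ring_scheme \<Rightarrow> ('k, 'b) bialgebra \<Rightarrow> ('k, 'e, 'b) comodule_algebra \<Rightarrow>
   ('e, 'm) module \<Rightarrow> ('b, 'q) module \<Rightarrow> ('e, ('m, 'q) tensor) module"
  where "mtensor K B E M Q = (let T = ktensor K (restrict_base E M) (restrict_base B Q) in
    as_module T (\<lambda>e. tlift T (\<lambda>m q.
      tlift T (\<lambda>e0 e1. mpure K B E M Q (e0 \<odot>\<^bsub>M\<^esub> m) (e1 \<odot>\<^bsub>Q\<^esub> q)) (coact E e))))"

definition mtensor_map ::
  "('k, 'c) ring_scheme \<Rightarrow> ('k, 'b) bialgebra \<Rightarrow> ('k, 'e, 'b) comodule_algebra \<Rightarrow>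
   ('e, 'n) module \<Rightarrow> ('b, 'p) module \<Rightarrow> ('m \<Rightarrow> 'n) \<Rightarrow> ('q \<Rightarrow> 'p) \<Rightarrow>
   ('m, 'q) tensor \<Rightarrow> ('n, 'p) tensor"
  where "mtensor_map K B E N P h k =
    tlift (mtensor K B E N P) (\<lambda>m q. mpure K B E N P (h m) (k q))"


section \<open>Functors between module categories and natural transformations\<close>

text \<open>The category of left \<open>R\<close>-modules with elements in a fixed type. Its morphisms are
  functions, which matter only on the carrier of their domain.\<close>

record ('r, 'm, 's, 'x) mod_functor =
  obj :: "('r, 'm) module \<Rightarrow> ('s, 'x) module"
  arr :: "('r, 'm) module \<Rightarrow> ('r, 'm) module \<Rightarrow> ('m \<Rightarrow> 'm) \<Rightarrow> 'x \<Rightarrow> 'x"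

definition is_mod_functor ::
  "('r, 'c) ring_scheme \<Rightarrow> ('s, 'd) ring_scheme \<Rightarrow> ('r, 'm, 's, 'x) mod_functor \<Rightarrow> bool"
  where "is_mod_functor R S F \<longleftrightarrow>
    (\<forall>M. left_module R M \<longrightarrow> left_module S (obj F M)) \<and>
    (\<forall>M N h. left_module R M \<longrightarrow> left_module R N \<longrightarrow> h \<in> lmod_hom R M N \<longrightarrow>
       arr F M N h \<in> lmod_hom S (obj F M) (obj F N)) \<and>
    (\<forall>M N h h'. left_module R M \<longrightarrow> left_module R N \<longrightarrow>
       h \<in> lmod_hom R M N \<longrightarrow> h' \<in> lmod_hom R M N \<longrightarrow> (\<forall>m \<in> carrier M. h m = h' m) \<longrightarrow>
       (\<forall>x \<in> carrier (obj F M). arr F M N h x = arr F M N h' x)) \<and>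
    (\<forall>M. left_module R M \<longrightarrow> (\<forall>x \<in> carrier (obj F M). arr F M M (\<lambda>m. m) x = x)) \<and>
    (\<forall>L M N h k. left_module R L \<longrightarrow> left_module R M \<longrightarrow> left_module R N \<longrightarrow>
       h \<in> lmod_hom R L M \<longrightarrow> k \<in> lmod_hom R M N \<longrightarrow>
       (\<forall>x \<in> carrier (obj F L). arr F L N (k \<circ> h) x = arr F M N k (arr F L M h x)))"

definition functor_comp ::
  "('s, 'x, 't, 'y) mod_functor \<Rightarrow> ('r, 'm, 's, 'x) mod_functor \<Rightarrow> ('r, 'm, 't, 'y) mod_functor"
    (infixl \<open>\<odot>\<^sub>F\<close> 70)
  where "G \<odot>\<^sub>F F =
    \<lparr>obj = (\<lambda>M. obj G (obj F M)),
     arr = (\<lambda>M N h. arr G (obj F M) (obj F N) (arr F M N h))\<rparr>"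

type_synonym ('r, 'm, 'x, 'y) components = "('r, 'm) module \<Rightarrow> 'x \<Rightarrow> 'y"

definition nat_transf ::
  "('r, 'c) ring_scheme \<Rightarrow> ('s, 'd) ring_scheme \<Rightarrow> ('r, 'm, 's, 'x) mod_functor \<Rightarrow>
   ('r, 'm, 's, 'y) mod_functor \<Rightarrow> ('r, 'm, 'x, 'y) components \<Rightarrow> bool"
  where "nat_transf R S F G \<eta> \<longleftrightarrow>
    is_mod_functor R S F \<and> is_mod_functor R S G \<and>
    (\<forall>M. left_module R M \<longrightarrow> \<eta> M \<in> lmod_hom S (obj F M) (obj G M)) \<and>
    (\<forall>M N h. left_module R M \<longrightarrow> left_module R N \<longrightarrow> h \<in> lmod_hom R M N \<longrightarrow>
       (\<forall>x \<in> carrier (obj F M). \<eta> N (arr F M N h x) = arr G M N h (\<eta> M x)))"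

definition nat_isom ::
  "('r, 'c) ring_scheme \<Rightarrow> ('s, 'd) ring_scheme \<Rightarrow> ('r, 'm, 's, 'x) mod_functor \<Rightarrow>
   ('r, 'm, 's, 'y) mod_functor \<Rightarrow> ('r, 'm, 'x, 'y) components \<Rightarrow> bool"
  where "nat_isom R S F G \<eta> \<longleftrightarrow> nat_transf R S F G \<eta> \<and>
    (\<forall>M. left_module R M \<longrightarrow> \<eta> M \<in> lmod_iso S (obj F M) (obj G M))"

definition vert_comp ::
  "('r, 'm, 'y, 'z) components \<Rightarrow> ('r, 'm, 'x, 'y) components \<Rightarrow> ('r, 'm, 'x, 'z) components"
  where "vert_comp \<eta> \<theta> = (\<lambda>M. \<eta> M \<circ> \<theta> M)"

definition whisker_right ::
  "('s, 'x, 'y, 'z) components \<Rightarrow> ('r, 'm, 's, 'x) mod_functor \<Rightarrow> ('r, 'm, 'y, 'z) components"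
  where "whisker_right \<eta> F = (\<lambda>M. \<eta> (obj F M))"


section \<open>The functors and 2-cells under consideration\<close>

definition ext_functor ::
  "('a, 'c) ring_scheme \<Rightarrow> ('a \<Rightarrow> 'a') \<Rightarrow> ('a', 'd) ring_scheme \<Rightarrow>
   ('a, 'm, 'a', ('a', 'm) tensor) mod_functor"
  where "ext_functor A f A' = \<lparr>obj = ext A f A', arr = (\<lambda>M N. ext_map A f A' N)\<rparr>"

text \<open>Whiskering on the left by \<open>f\<^sup>*\<close> goes between different types of modules, hence is not
  an instance of the arrow part of one \<open>ext_functor\<close>; \<open>F\<close> is the target of \<open>\<theta>\<close>.\<close>

definition ext_whisker ::
  "('a, 'c) ring_scheme \<Rightarrow> ('a \<Rightarrow> 'a') \<Rightarrow> ('a', 'd) ring_scheme \<Rightarrow>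
   ('r, 'm, 'a, 'y) mod_functor \<Rightarrow> ('r, 'm, 'x, 'y) components \<Rightarrow>
   ('r, 'm, ('a', 'x) tensor, ('a', 'y) tensor) components"
  where "ext_whisker A f A' F \<theta> = (\<lambda>M. ext_map A f A' (obj F M) (\<theta> M))"

definition G_functor ::
  "('k, 'c) ring_scheme \<Rightarrow> ('k, 'b) bialgebra \<Rightarrow> ('k, 'e, 'b) comodule_algebra \<Rightarrow>
   ('e, 'm, 'e, ('m, 'b) tensor) mod_functor"
  where "G_functor K B E =
    \<lparr>obj = (\<lambda>M. mtensor K B E M (regular_module B)),
     arr = (\<lambda>M N h. mtensor_map K B E N (regular_module B) h (\<lambda>b. b))\<rparr>"

definition alpha ::
  "('k, 'c) ring_scheme \<Rightarrow> ('k, 'b) bialgebra \<Rightarrow> ('k, 'b') bialgebra \<Rightarrow>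
   ('k, 'e, 'b) comodule_algebra \<Rightarrow> ('k, 'e', 'b') comodule_algebra \<Rightarrow>
   ('e \<Rightarrow> 'e') \<Rightarrow> ('b \<Rightarrow> 'b') \<Rightarrow> ('e, 'm) module \<Rightarrow> ('b, 'q) module \<Rightarrow>
   ('e', ('m, 'q) tensor) tensor \<Rightarrow> (('e', 'm) tensor, ('b', 'q) tensor) tensor"
  where "alpha K B B' E E' f \<phi> M Q =
    (let fM = ext E f E' M; \<phi>Q = ext B \<phi> B' Q; T = mtensor K B' E' fM \<phi>Q in
     tlift T (\<lambda>e' t. tlift T (\<lambda>m q.
       tlift T (\<lambda>e0 e1. mpure K B' E' fM \<phi>Q (ext_pure E f E' M e0 m) (ext_pure B \<phi> B' Q e1 q))
         (coact E' e')) t))"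

text \<open>The identification of \<open>B' \<otimes>\<^sub>B B\<close> with \<open>B'\<close>.\<close>

definition ext_regular ::
  "('b \<Rightarrow> 'b') \<Rightarrow> ('b', 'd) ring_scheme \<Rightarrow> ('b', 'b) tensor \<Rightarrow> 'b'"
  where "ext_regular \<phi> B' = tlift B' (\<lambda>b' b. b' \<otimes>\<^bsub>B'\<^esub> \<phi> b)"

definition alpha_at ::
  "('k, 'c) ring_scheme \<Rightarrow> ('k, 'b) bialgebra \<Rightarrow> ('k, 'b') bialgebra \<Rightarrow>
   ('k, 'e, 'b) comodule_algebra \<Rightarrow> ('k, 'e', 'b') comodule_algebra \<Rightarrow>
   ('e \<Rightarrow> 'e') \<Rightarrow> ('b \<Rightarrow> 'b') \<Rightarrow>
   ('e, 'm, ('e', ('m, 'b) tensor) tensor, (('e', 'm) tensor, 'b') tensor) components"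
  where "alpha_at K B B' E E' f \<phi> = (\<lambda>M.
    mtensor_map K B' E' (ext E f E' M) (regular_module B') (\<lambda>x. x) (ext_regular \<phi> B') \<circ>
    alpha K B B' E E' f \<phi> M (regular_module B))"

end

theory Submission
  imports Defs
begin

text \<open>Sweedler sums need not be manipulated to prove the pasting identity. For an algebra map
  \<open>f : E \<rightarrow> E'\<close>, extension of scalars has the universal property that every additive map
  \<open>h : M \<rightarrow> N\<close> into an \<open>E'\<close>-module with \<open>h (e m) = f(e) h(m)\<close> (an \<open>f\<close>-semilinear map) extends uniquely
  to an \<open>E'\<close>-linear map \<open>E' \<otimes>\<^sub>E M \<rightarrow> N\<close> with \<open>1 \<otimes> m \<mapsto> h m\<close>. The map \<open>\<alpha>\<close> is of this kind: since
  \<open>\<Sum> (e'\<^sub>0 \<otimes> m) \<otimes> (e'\<^sub>1 \<otimes> q) = e' \<cdot> ((1 \<otimes> m) \<otimes> (1 \<otimes> q))\<close>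
  for the diagonal action, \<open>\<alpha>\<close> is the extension of \<open>m \<otimes> q \<mapsto> (1 \<otimes> m) \<otimes> (1 \<otimes> q)\<close>, the tensor product of two
  unit maps (lemma \<open>alpha\<close>). The maps \<open>ext_map\<close>, \<open>can\<close> and \<open>ext_regular\<close> are
  extensions of the same sort.

  Hence a linear map on \<open>g\<^sup>* f\<^sup>* (M \<otimes> Q)\<close> is determined by its values on the elements
  \<open>1 \<otimes> (1 \<otimes> (m \<otimes> q))\<close> (lemma \<open>ext_ext_mtensor_hom_eq\<close>), and both sides of the pasting identity send
  such an element to \<open>(1 \<otimes> m) \<otimes> (1 \<otimes> q)\<close>. At \<open>Q = B\<close> both sides send \<open>1 \<otimes> (1 \<otimes> (m \<otimes> b))\<close> to
  \<open>(1 \<otimes> m) \<otimes> \<phi>' (\<phi> b)\<close>. The functor laws, naturality, and the invertibility of \<open>can\<close> are checked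
  on such generators as well.

  The coactions enter through two facts: \<open>M \<otimes> Q\<close> is an \<open>E\<close>-module because
  it is an \<open>E \<otimes> B\<close>-module restricted along the algebra map \<open>\<rho>\<close> (lemma \<open>left_module_mtensor\<close>),
  and the tensor product of an \<open>f\<close>-semilinear and a \<open>\<phi>\<close>-semilinear map is \<open>f\<close>-semilinear because
  \<open>\<rho>' \<circ> f = (f \<otimes> \<phi>) \<circ> \<rho>\<close> (lemma \<open>mtensor_map\<close>).\<close>

section \<open>Tensor products and additive maps\<close>

text \<open>The library's \<open>hom (add_monoid X) (add_monoid Z)\<close>, but mentioning only carriers and additions: the
  additive monoids of a ring and of a module with the same addition differ in type, whereas
  \<open>add_hom\<close> does not distinguish the two.\<close>

definition add_hom :: "('x, 'c) ring_scheme \<Rightarrow> ('z, 'd) ring_scheme \<Rightarrow> ('x \<Rightarrow> 'z) set"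
  where "add_hom X Z = {h. (\<forall>x \<in> carrier X. h x \<in> carrier Z) \<and>
    (\<forall>x \<in> carrier X. \<forall>y \<in> carrier X. h (x \<oplus>\<^bsub>X\<^esub> y) = h x \<oplus>\<^bsub>Z\<^esub> h y)}"

lemma hom_add_monoid: "hom (add_monoid X) (add_monoid Z) = add_hom X Z"
  by (auto simp: hom_def add_hom_def)

lemma add_homI:
  assumes "\<And>x. x \<in> carrier X \<Longrightarrow> h x \<in> carrier Z"
    and "\<And>x y. \<lbrakk>x \<in> carrier X; y \<in> carrier X\<rbrakk> \<Longrightarrow> h (x \<oplus>\<^bsub>X\<^esub> y) = h x \<oplus>\<^bsub>Z\<^esub> h y"
  shows "h \<in> add_hom X Z"
  using assms by (auto simp: add_hom_def)

lemma add_hom_closed: "\<lbrakk>h \<in> add_hom X Z; x \<in> carrier X\<rbrakk> \<Longrightarrow> h x \<in> carrier Z"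
  by (auto simp: add_hom_def)

lemma add_hom_add:
  "\<lbrakk>h \<in> add_hom X Z; x \<in> carrier X; y \<in> carrier X\<rbrakk> \<Longrightarrow> h (x \<oplus>\<^bsub>X\<^esub> y) = h x \<oplus>\<^bsub>Z\<^esub> h y"
  by (auto simp: add_hom_def)

lemma add_hom_comp:
  "\<lbrakk>u \<in> add_hom V Z; h \<in> add_hom Z W\<rbrakk> \<Longrightarrow> (\<lambda>v. h (u v)) \<in> add_hom V W"
  by (auto simp: add_hom_def)

lemma add_hom_cong:
  assumes "abelian_group X" and h: "h \<in> add_hom X Z"
    and eq: "\<And>x. x \<in> carrier X \<Longrightarrow> h x = h' x"
  shows "h' \<in> add_hom X Z"
proof -
  interpret X: abelian_group X by fact
  show ?thesis
    using add_hom_closed[OF h] add_hom_add[OF h] by (intro add_homI) (simp_all add: eq[symmetric])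
qed

text \<open>A tensor product is a bare group in \<open>tensor\<close> and carries an action in \<open>ext\<close>, \<open>mtensor\<close> and
  \<open>alg_tensor\<close>. This lemma and the next one pass between these records.\<close>

lemma abelian_group_transfer:
  assumes Z: "abelian_group Z" and "carrier Z' = carrier Z" "add Z' = add Z" "\<zero>\<^bsub>Z'\<^esub> = \<zero>\<^bsub>Z\<^esub>"
  shows "abelian_group Z'"
proof -
  interpret Z: abelian_group Z by (rule Z)
  show ?thesis
    by (rule abelian_groupI) (auto simp: assms(2-) Z.a_ac intro: bexI[of _ "\<ominus>\<^bsub>Z\<^esub> _"] Z.l_neg)
qed

lemma tlift_transfer:
  assumes "carrier Z' = carrier Z" "add Z' = add Z" "\<zero>\<^bsub>Z'\<^esub> = \<zero>\<^bsub>Z\<^esub>"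
  shows "tlift Z' = tlift Z"
  using assms
  by (intro ext) (simp add: tlift_def free_lift_def finsum_def add_pow_def finprod_def
      int_pow_def nat_pow_def m_inv_def cong: if_cong)

definition balanced ::
  "('r, 'c) ring_scheme \<Rightarrow> ('x, 'd) ring_scheme \<Rightarrow> ('x \<Rightarrow> 'r \<Rightarrow> 'x) \<Rightarrow>
   ('r, 'y, 'e) module_scheme \<Rightarrow> ('z, 'g) ring_scheme \<Rightarrow> ('x \<Rightarrow> 'y \<Rightarrow> 'z) \<Rightarrow> bool"
  where "balanced R X xr Y Z \<beta> \<longleftrightarrow>
    (\<forall>x \<in> carrier X. \<beta> x \<in> add_hom Y Z) \<and>
    (\<forall>y \<in> carrier Y. (\<lambda>x. \<beta> x y) \<in> add_hom X Z) \<and>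
    (\<forall>x \<in> carrier X. \<forall>r \<in> carrier R. \<forall>y \<in> carrier Y. \<beta> (xr x r) y = \<beta> x (r \<odot>\<^bsub>Y\<^esub> y))"

lemma balancedI:
  assumes "\<And>x. x \<in> carrier X \<Longrightarrow> \<beta> x \<in> add_hom Y Z"
    and "\<And>y. y \<in> carrier Y \<Longrightarrow> (\<lambda>x. \<beta> x y) \<in> add_hom X Z"
    and "\<And>x r y. \<lbrakk>x \<in> carrier X; r \<in> carrier R; y \<in> carrier Y\<rbrakk>
           \<Longrightarrow> \<beta> (xr x r) y = \<beta> x (r \<odot>\<^bsub>Y\<^esub> y)"
  shows "balanced R X xr Y Z \<beta>"
  using assms by (simp add: balanced_def)

lemma balancedD:
  assumes "balanced R X xr Y Z \<beta>"
  shows "x \<in> carrier X \<Longrightarrow> \<beta> x \<in> add_hom Y Z"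
    and "y \<in> carrier Y \<Longrightarrow> (\<lambda>x. \<beta> x y) \<in> add_hom X Z"
    and "\<lbrakk>x \<in> carrier X; r \<in> carrier R; y \<in> carrier Y\<rbrakk> \<Longrightarrow> \<beta> (xr x r) y = \<beta> x (r \<odot>\<^bsub>Y\<^esub> y)"
    and "\<lbrakk>x \<in> carrier X; y \<in> carrier Y\<rbrakk> \<Longrightarrow> \<beta> x y \<in> carrier Z"
  using assms unfolding balanced_def by (blast intro: add_hom_closed)+

lemma balanced_comp:
  assumes b: "balanced R X xr Y Z \<beta>" and h: "h \<in> add_hom Z W"
  shows "balanced R X xr Y W (\<lambda>x y. h (\<beta> x y))"
  using b unfolding balanced_def by (auto intro: add_hom_comp[OF _ h])

text \<open>Stated for operations by \<open>R\<close> rather than for modules, so as to cover at once \<open>A' \<otimes>\<^sub>A M\<close>, \<open>M \<otimes> Q\<close> and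
  tensor products of algebras; the tensor product imposes the remaining relations by itself.\<close>

locale tensor_factors = X: abelian_group X + Y: abelian_group Y
  for R :: "('r, 'c) ring_scheme" and X :: "('x, 'd) ring_scheme" and xr :: "'x \<Rightarrow> 'r \<Rightarrow> 'x"
    and Y :: "('r, 'y, 'e) module_scheme" +
  assumes xr_closed: "\<lbrakk>x \<in> carrier X; r \<in> carrier R\<rbrakk> \<Longrightarrow> xr x r \<in> carrier X"
    and yl_closed: "\<lbrakk>r \<in> carrier R; y \<in> carrier Y\<rbrakk> \<Longrightarrow> r \<odot>\<^bsub>Y\<^esub> y \<in> carrier Y"
begin

abbreviation "T \<equiv> tensor R X xr Y"
abbreviation "pure \<equiv> tpure R X xr Y"
abbreviation "free \<equiv> free_Abelian_group (carrier X \<times> carrier Y)"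
abbreviation "null \<equiv> tensor_null R X xr Y"

lemma relators_closed: "tensor_relators R X xr Y \<subseteq> carrier free"
  using xr_closed yl_closed by (auto simp: tensor_relators_def dest!: subsetD[OF keys_diff])

lemma null_subgroup: "subgroup null free"
proof -
  interpret F: comm_group free by (rule abelian_free_Abelian_group)
  show ?thesis unfolding tensor_null_def by (rule F.generate_is_subgroup[OF relators_closed])
qed

lemma null_normal: "null \<lhd> free"
proof -
  interpret F: comm_group free by (rule abelian_free_Abelian_group)
  show ?thesis using null_subgroup by (simp add: F.normal_iff_subgroup)
qed

lemma tensor_group_eq: "add_monoid T = tensor_group R X xr Y"
  by (simp add: tensor_def tensor_group_def FactGroup_def)

lemma abelian_group_tensor: "abelian_group T"
proof -
  interpret F: comm_group free by (rule abelian_free_Abelian_group)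
  have "comm_group (add_monoid T)"
    unfolding tensor_group_eq tensor_group_def by (rule F.abelian_FactGroup[OF null_subgroup])
  then show ?thesis by (rule comm_group_abelian_groupI)
qed

sublocale T: abelian_group T by (rule abelian_group_tensor)

lemma tensor_carrier: "carrier T = (\<lambda>a. null #>\<^bsub>free\<^esub> a) ` carrier free"
  by (simp add: tensor_def tensor_group_def carrier_FactGroup)

lemma coset_add:
  assumes "a \<in> carrier free" "b \<in> carrier free"
  shows "(null #>\<^bsub>free\<^esub> a) \<oplus>\<^bsub>T\<^esub> (null #>\<^bsub>free\<^esub> b) = null #>\<^bsub>free\<^esub> (a + b)"
  using normal.rcos_sum[OF null_normal assms] by (simp add: tensor_def tensor_group_def)

lemma coset_relator:
  assumes r: "a - b \<in> tensor_relators R X xr Y" and a: "a \<in> carrier free" and b: "b \<in> carrier free"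
  shows "null #>\<^bsub>free\<^esub> a = null #>\<^bsub>free\<^esub> b"
proof -
  interpret F: comm_group free by (rule abelian_free_Abelian_group)
  have "a - b \<in> null" unfolding tensor_null_def by (rule generate.incl[OF r])
  then have "(a - b) \<otimes>\<^bsub>free\<^esub> b \<in> null #>\<^bsub>free\<^esub> b" unfolding r_coset_def by blast
  then have "a \<in> null #>\<^bsub>free\<^esub> b" by simp
  from F.repr_independence[OF this b null_subgroup] show ?thesis by simp
qed

lemma pure_closed [simp]: "\<lbrakk>x \<in> carrier X; y \<in> carrier Y\<rbrakk> \<Longrightarrow> pure x y \<in> carrier T"
  by (auto simp: tpure_def tensor_carrier)

lemma balanced_pure: "balanced R X xr Y T pure"
proof (intro balancedI add_homI)
  fix x y y' assume [simp]: "x \<in> carrier X" "y \<in> carrier Y" "y' \<in> carrier Y"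
  have "null #>\<^bsub>free\<^esub> frag_of (x, y \<oplus>\<^bsub>Y\<^esub> y') = null #>\<^bsub>free\<^esub> (frag_of (x, y) + frag_of (x, y'))"
  proof (rule coset_relator)
    show "frag_of (x, y \<oplus>\<^bsub>Y\<^esub> y') - (frag_of (x, y) + frag_of (x, y')) \<in> tensor_relators R X xr Y"
      unfolding diff_diff_eq[symmetric] tensor_relators_def
      by (rule UnI1, rule UnI2, intro CollectI exI conjI, rule refl) simp_all
  qed (auto dest!: subsetD[OF keys_add])
  then show "pure x (y \<oplus>\<^bsub>Y\<^esub> y') = pure x y \<oplus>\<^bsub>T\<^esub> pure x y'"
    by (simp add: tpure_def coset_add)
next
  fix x x' y assume [simp]: "x \<in> carrier X" "x' \<in> carrier X" "y \<in> carrier Y"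
  have "null #>\<^bsub>free\<^esub> frag_of (x \<oplus>\<^bsub>X\<^esub> x', y) = null #>\<^bsub>free\<^esub> (frag_of (x, y) + frag_of (x', y))"
  proof (rule coset_relator)
    show "frag_of (x \<oplus>\<^bsub>X\<^esub> x', y) - (frag_of (x, y) + frag_of (x', y)) \<in> tensor_relators R X xr Y"
      unfolding diff_diff_eq[symmetric] tensor_relators_def
      by (rule UnI1, rule UnI1, intro CollectI exI conjI, rule refl) simp_all
  qed (auto dest!: subsetD[OF keys_add])
  then show "pure (x \<oplus>\<^bsub>X\<^esub> x') y = pure x y \<oplus>\<^bsub>T\<^esub> pure x' y"
    by (simp add: tpure_def coset_add)
next
  fix x r y assume [simp]: "x \<in> carrier X" "r \<in> carrier R" "y \<in> carrier Y"
  have "null #>\<^bsub>free\<^esub> frag_of (xr x r, y) = null #>\<^bsub>free\<^esub> frag_of (x, r \<odot>\<^bsub>Y\<^esub> y)"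
  proof (rule coset_relator)
    show "frag_of (xr x r, y) - frag_of (x, r \<odot>\<^bsub>Y\<^esub> y) \<in> tensor_relators R X xr Y"
      unfolding tensor_relators_def by (rule UnI2, intro CollectI exI conjI, rule refl) simp_all
  qed (simp_all add: xr_closed yl_closed)
  then show "pure (xr x r) y = pure x (r \<odot>\<^bsub>Y\<^esub> y)" by (simp add: tpure_def)
qed simp_all

lemmas pure_hom_right = balancedD(1)[OF balanced_pure]
  and pure_hom_left = balancedD(2)[OF balanced_pure]
  and pure_balanced = balancedD(3)[OF balanced_pure]

text \<open>Sums of pure tensors already form a subgroup, since \<open>- (x \<otimes> y) = (- x) \<otimes> y\<close>.\<close>

lemma tensor_induct [consumes 1, case_names pure add]:
  assumes t: "t \<in> carrier T"
    and pure: "\<And>x y. \<lbrakk>x \<in> carrier X; y \<in> carrier Y\<rbrakk> \<Longrightarrow> P (pure x y)"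
    and add: "\<And>s t. \<lbrakk>s \<in> carrier T; t \<in> carrier T; P s; P t\<rbrakk> \<Longrightarrow> P (s \<oplus>\<^bsub>T\<^esub> t)"
  shows "P t"
proof -
  let ?c = "\<lambda>a. null #>\<^bsub>free\<^esub> a"
  interpret F: comm_group free by (rule abelian_free_Abelian_group)
  have Nsub: "null \<subseteq> carrier free" using null_subgroup by (rule subgroup.subset)
  have c0: "?c 0 = \<zero>\<^bsub>T\<^esub>" using F.coset_mult_one[OF Nsub] by (simp add: tensor_def tensor_group_def)
  have cl: "?c a \<in> carrier T" if "a \<in> carrier free" for a using that tensor_carrier by blast
  have z: "pure \<zero>\<^bsub>X\<^esub> y = \<zero>\<^bsub>T\<^esub>" if [simp]: "y \<in> carrier Y" for y
    using add_hom_add[OF pure_hom_left[of y], of "\<zero>\<^bsub>X\<^esub>" "\<zero>\<^bsub>X\<^esub>"] by simp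
  have P0: "P \<zero>\<^bsub>T\<^esub>" using pure[of "\<zero>\<^bsub>X\<^esub>" "\<zero>\<^bsub>Y\<^esub>"] z by simp
  have neg: "?c (- frag_of (x, y)) = pure (\<ominus>\<^bsub>X\<^esub> x) y" if [simp]: "x \<in> carrier X" "y \<in> carrier Y" for x y
  proof -
    have "?c (- frag_of (x, y)) \<oplus>\<^bsub>T\<^esub> pure x y = \<zero>\<^bsub>T\<^esub>"
      using coset_add[of "- frag_of (x, y)" "frag_of (x, y)"] by (simp add: tpure_def c0)
    moreover have "pure (\<ominus>\<^bsub>X\<^esub> x) y \<oplus>\<^bsub>T\<^esub> pure x y = \<zero>\<^bsub>T\<^esub>"
      using add_hom_add[OF pure_hom_left[of y], of "\<ominus>\<^bsub>X\<^esub> x" x] z by (simp add: X.l_neg)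
    ultimately show ?thesis
      using T.minus_equality[of "?c (- frag_of (x, y))" "pure x y"]
        T.minus_equality[of "pure (\<ominus>\<^bsub>X\<^esub> x) y" "pure x y"] cl by simp
  qed
  have "Poly_Mapping.keys a \<subseteq> carrier X \<times> carrier Y \<Longrightarrow>
      Poly_Mapping.keys a \<subseteq> carrier X \<times> carrier Y \<and> P (?c a) \<and> P (?c (- a))" for a
  proof (induction rule: frag_induction)
    case zero
    then show ?case by (simp add: c0 P0)
  next
    case (one p)
    then obtain x y where "p = (x, y)" "x \<in> carrier X" "y \<in> carrier Y" by auto
    then show ?case using pure[of x y] pure[of "\<ominus>\<^bsub>X\<^esub> x" y] neg[of x y] by (simp add: tpure_def)
  next
    case (diff a b)
    have "P (?c (u - v))" if "u \<in> carrier free" "v \<in> carrier free" "P (?c u)" "P (?c (- v))" for u v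
      using that add[of "?c u" "?c (- v)"] cl coset_add[of u "- v"] by simp
    from this[of a b] this[of b a] show ?case
      using diff keys_diff[of a b] by auto
  qed
  then show ?thesis using t tensor_carrier by auto
qed

context
  fixes Z :: "('z, 'g) ring_scheme" and \<beta>
  assumes Z: "abelian_group Z" and b: "balanced R X xr Y Z \<beta>"
begin

lemma tlift_hom: "tlift Z \<beta> \<in> add_hom T Z"
  unfolding hom_add_monoid[symmetric]
  by (rule tlift_tpure(1))
     (use b Z xr_closed yl_closed X.abelian_group_axioms Y.abelian_group_axioms in
       \<open>auto simp: balanced_def add_hom_def\<close>)

lemma tlift_pure: "\<lbrakk>x \<in> carrier X; y \<in> carrier Y\<rbrakk> \<Longrightarrow> tlift Z \<beta> (pure x y) = \<beta> x y"
  by (rule tlift_tpure(2))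
     (use b Z xr_closed yl_closed X.abelian_group_axioms Y.abelian_group_axioms in
       \<open>auto simp: balanced_def add_hom_def\<close>)

end

text \<open>Uniqueness in the universal property of the tensor product; \<open>tlift_hom\<close> and \<open>tlift_pure\<close> are existence.\<close>

lemma tensor_hom_eq:
  assumes "u \<in> add_hom T Z" and "v \<in> add_hom T Z"
    and "\<And>x y. \<lbrakk>x \<in> carrier X; y \<in> carrier Y\<rbrakk> \<Longrightarrow> u (pure x y) = v (pure x y)"
    and "t \<in> carrier T"
  shows "u t = v t"
  using assms(4) by (induction rule: tensor_induct) (simp_all add: assms(3) add_hom_add[OF assms(1)] add_hom_add[OF assms(2)])

text \<open>A coset contains only formal sums of pairs from the carriers, so values elsewhere do not matter.\<close>

lemma tlift_cong:
  assumes Z: "abelian_group Z" and t: "t \<in> carrier T"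
    and eq: "\<And>x y. \<lbrakk>x \<in> carrier X; y \<in> carrier Y\<rbrakk> \<Longrightarrow> \<beta> x y = \<gamma> x y"
    and cl: "\<And>x y. \<lbrakk>x \<in> carrier X; y \<in> carrier Y\<rbrakk> \<Longrightarrow> \<gamma> x y \<in> carrier Z"
  shows "tlift Z \<beta> t = tlift Z \<gamma> t"
proof -
  interpret Z: abelian_group Z by (rule Z)
  interpret F: comm_group free by (rule abelian_free_Abelian_group)
  from t obtain a0 where a0: "a0 \<in> carrier free" "t = null #>\<^bsub>free\<^esub> a0" using tensor_carrier by auto
  have "t \<subseteq> carrier free"
    unfolding a0(2) using a0(1) subgroup.subset[OF null_subgroup] by (rule F.r_coset_subset_G[rotated])
  have "free_lift Z \<beta> a = free_lift Z \<gamma> a" if "a \<in> t" for a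
  proof -
    from that \<open>t \<subseteq> carrier free\<close> have k: "Poly_Mapping.keys a \<subseteq> carrier X \<times> carrier Y"
      by (auto simp del: carrier_free_Abelian_group_iff simp: carrier_free_Abelian_group_iff[symmetric])
    show ?thesis unfolding free_lift_def
    proof (rule Z.finsum_cong'[OF refl])
      show "(\<lambda>p. add_pow Z (Poly_Mapping.lookup a p) (\<gamma> (fst p) (snd p))) \<in> Poly_Mapping.keys a \<rightarrow> carrier Z"
        using k cl Z.add.int_pow_closed by auto
    next
      fix p assume "p \<in> Poly_Mapping.keys a"
      with k have "fst p \<in> carrier X" "snd p \<in> carrier Y" by auto
      then show "add_pow Z (Poly_Mapping.lookup a p) (\<beta> (fst p) (snd p)) =
          add_pow Z (Poly_Mapping.lookup a p) (\<gamma> (fst p) (snd p))" by (simp add: eq)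
    qed
  qed
  then have "free_lift Z \<beta> ` t = free_lift Z \<gamma> ` t" by (rule image_cong[OF refl])
  then show ?thesis by (simp add: tlift_def)
qed

lemma tlift_comp:
  assumes Z: "abelian_group Z" and W: "abelian_group W" and b: "balanced R X xr Y Z \<beta>"
    and h: "h \<in> add_hom Z W" and t: "t \<in> carrier T"
  shows "h (tlift Z \<beta> t) = tlift W (\<lambda>x y. h (\<beta> x y)) t"
proof -
  note b' = balanced_comp[OF b h]
  have "(\<lambda>t. h (tlift Z \<beta> t)) \<in> add_hom T W"
    by (rule add_hom_comp[OF tlift_hom[OF Z b] h])
  from tensor_hom_eq[OF this tlift_hom[OF W b'] _ t] show ?thesis
    by (simp add: tlift_pure[OF Z b] tlift_pure[OF W b'])
qed

text \<open>In Sweedler notation: \<open>\<Sum> t\<^sub>0 \<otimes> t\<^sub>1 = t\<close>.\<close>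

lemma tlift_pure_self: "t \<in> carrier T \<Longrightarrow> tlift T pure t = t"
  using tensor_hom_eq[OF tlift_hom[OF abelian_group_tensor balanced_pure], of "\<lambda>t. t" t]
    tlift_pure[OF abelian_group_tensor balanced_pure] by (simp add: add_hom_def)

text \<open>Linearity of \<open>t \<mapsto> H w t\<close> lets additivity in the parameter \<open>w\<close> spread from pure tensors to all
  tensors. This is how iterated Sweedler sums are seen to be additive in each argument.\<close>

lemma tensor_family_hom:
  assumes W: "\<And>v w. \<lbrakk>v \<in> carrier W; w \<in> carrier W\<rbrakk> \<Longrightarrow> v \<oplus>\<^bsub>W\<^esub> w \<in> carrier W"
    and Z: "abelian_group Z"
    and H: "\<And>w. w \<in> carrier W \<Longrightarrow> H w \<in> add_hom T Z"
    and p: "\<And>x y. \<lbrakk>x \<in> carrier X; y \<in> carrier Y\<rbrakk> \<Longrightarrow> (\<lambda>w. H w (pure x y)) \<in> add_hom W Z"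
    and t: "t \<in> carrier T"
  shows "(\<lambda>w. H w t) \<in> add_hom W Z"
proof (rule add_homI)
  interpret Z: abelian_group Z by (rule Z)
  note cl = add_hom_closed[OF H]
  show "H w t \<in> carrier Z" if "w \<in> carrier W" for w using cl that t by blast
  fix v w assume vw: "v \<in> carrier W" "w \<in> carrier W"
  from t show "H (v \<oplus>\<^bsub>W\<^esub> w) t = H v t \<oplus>\<^bsub>Z\<^esub> H w t"
  proof (induction rule: tensor_induct)
    case (pure x y)
    then show ?case using add_hom_add[OF p vw] by simp
  next
    case (add s t)
    then show ?case
      using vw W cl by (simp add: add_hom_add[OF H] Z.a_ac)
  qed
qed

end

section \<open>Tensor products over the base ring\<close>

definition closed_action :: "('k, 'c) ring_scheme \<Rightarrow> ('k, 'x, 'd) module_scheme \<Rightarrow> bool"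
  where "closed_action K X \<longleftrightarrow> abelian_group X \<and>
    (\<forall>c \<in> carrier K. \<forall>x \<in> carrier X. c \<odot>\<^bsub>X\<^esub> x \<in> carrier X)"

lemma ktensor_factors:
  assumes "closed_action K X" and "closed_action K Y"
  shows "tensor_factors K X (\<lambda>x c. c \<odot>\<^bsub>X\<^esub> x) Y"
  using assms by (simp add: closed_action_def tensor_factors_def tensor_factors_axioms_def)

lemma lmod_homI:
  assumes "\<And>m. m \<in> carrier M \<Longrightarrow> h m \<in> carrier N"
    and "\<And>m n. \<lbrakk>m \<in> carrier M; n \<in> carrier M\<rbrakk> \<Longrightarrow> h (m \<oplus>\<^bsub>M\<^esub> n) = h m \<oplus>\<^bsub>N\<^esub> h n"
    and "\<And>r m. \<lbrakk>r \<in> carrier R; m \<in> carrier M\<rbrakk> \<Longrightarrow> h (r \<odot>\<^bsub>M\<^esub> m) = r \<odot>\<^bsub>N\<^esub> h m"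
  shows "h \<in> lmod_hom R M N"
  using assms by (simp add: lmod_hom_def hom_add_monoid add_hom_def)

lemma lmod_homD:
  assumes "h \<in> lmod_hom R M N"
  shows "h \<in> add_hom M N"
    and "m \<in> carrier M \<Longrightarrow> h m \<in> carrier N"
    and "\<lbrakk>r \<in> carrier R; m \<in> carrier M\<rbrakk> \<Longrightarrow> h (r \<odot>\<^bsub>M\<^esub> m) = r \<odot>\<^bsub>N\<^esub> h m"
  using assms by (auto simp: lmod_hom_def hom_add_monoid add_hom_def)

lemma ktensor_map_balanced:
  assumes X': "closed_action K X'" and Y': "closed_action K Y'"
    and h: "h \<in> lmod_hom K X X'" and k: "k \<in> lmod_hom K Y Y'"
  shows "balanced K X (\<lambda>x c. c \<odot>\<^bsub>X\<^esub> x) Y (ktensor K X' Y') (\<lambda>x y. kpure K X' Y' (h x) (k y))"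
proof -
  interpret T': tensor_factors K X' "\<lambda>x c. c \<odot>\<^bsub>X'\<^esub> x" Y' by (rule ktensor_factors[OF X' Y'])
  show ?thesis
  proof (rule balancedI)
    show "(\<lambda>y. kpure K X' Y' (h x) (k y)) \<in> add_hom Y (ktensor K X' Y')" if "x \<in> carrier X" for x
      by (rule add_hom_comp[OF lmod_homD(1)[OF k] T'.pure_hom_right[OF lmod_homD(2)[OF h that]]])
    show "(\<lambda>x. kpure K X' Y' (h x) (k y)) \<in> add_hom X (ktensor K X' Y')" if "y \<in> carrier Y" for y
      by (rule add_hom_comp[OF lmod_homD(1)[OF h] T'.pure_hom_left[OF lmod_homD(2)[OF k that]]])
    show "kpure K X' Y' (h (c \<odot>\<^bsub>X\<^esub> x)) (k y) = kpure K X' Y' (h x) (k (c \<odot>\<^bsub>Y\<^esub> y))"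
      if "x \<in> carrier X" "c \<in> carrier K" "y \<in> carrier Y" for x c y
      using that T'.pure_balanced[of "h x" c "k y"] by (simp add: lmod_homD[OF h] lmod_homD[OF k])
  qed
qed

definition kbilinear ::
  "('k, 'c) ring_scheme \<Rightarrow> ('k, 'x, 'd) module_scheme \<Rightarrow> ('k, 'y, 'e) module_scheme \<Rightarrow>
   ('k, 'z, 'g) module_scheme \<Rightarrow> ('x \<Rightarrow> 'y \<Rightarrow> 'z) \<Rightarrow> bool"
  where "kbilinear K X Y Z p \<longleftrightarrow>
    (\<forall>x \<in> carrier X. p x \<in> lmod_hom K Y Z) \<and> (\<forall>y \<in> carrier Y. (\<lambda>x. p x y) \<in> lmod_hom K X Z)"

text \<open>Both the multiplication of \<open>A \<otimes> B\<close> and the action of \<open>A \<otimes> B\<close> on \<open>M \<otimes> Q\<close> have the form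
  \<open>(x \<otimes> y, x' \<otimes> y') \<mapsto> p x x' \<otimes> q y y'\<close> for \<open>K\<close>-bilinear \<open>p\<close> and \<open>q\<close>.\<close>

definition kmap2 ::
  "('k, 'c) ring_scheme \<Rightarrow> ('k, 'z, 'd) module_scheme \<Rightarrow> ('k, 'z', 'e) module_scheme \<Rightarrow>
   ('x \<Rightarrow> 'y \<Rightarrow> 'z) \<Rightarrow> ('x' \<Rightarrow> 'y' \<Rightarrow> 'z') \<Rightarrow> ('x, 'x') tensor \<Rightarrow> ('y, 'y') tensor \<Rightarrow> ('z, 'z') tensor"
  where "kmap2 K Z Z' p q s t =
    tlift (ktensor K Z Z') (\<lambda>x x'. tlift (ktensor K Z Z') (\<lambda>y y'. kpure K Z Z' (p x y) (q x' y')) t) s"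

lemma kmap2:
  fixes K :: "('k, 'c) ring_scheme" and Z :: "('k, 'z, 'g) module_scheme"
    and Z' :: "('k, 'z', 'g') module_scheme"
  assumes X: "closed_action K X" and X': "closed_action K X'" and Y: "closed_action K Y" and Y': "closed_action K Y'"
    and Z: "closed_action K Z" and Z': "closed_action K Z'"
    and p: "kbilinear K X Y Z p" and q: "kbilinear K X' Y' Z' q"
  shows kmap2_hom_right: "s \<in> carrier (ktensor K X X') \<Longrightarrow>
      kmap2 K Z Z' p q s \<in> add_hom (ktensor K Y Y') (ktensor K Z Z')"
    and kmap2_hom_left: "t \<in> carrier (ktensor K Y Y') \<Longrightarrow>
      (\<lambda>s. kmap2 K Z Z' p q s t) \<in> add_hom (ktensor K X X') (ktensor K Z Z')"
    and kmap2_pure: "\<lbrakk>x \<in> carrier X; x' \<in> carrier X'; y \<in> carrier Y; y' \<in> carrier Y'\<rbrakk> \<Longrightarrow>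
      kmap2 K Z Z' p q (kpure K X X' x x') (kpure K Y Y' y y') = kpure K Z Z' (p x y) (q x' y')"
proof -
  interpret TX: tensor_factors K X "\<lambda>x c. c \<odot>\<^bsub>X\<^esub> x" X' by (rule ktensor_factors[OF X X'])
  interpret TY: tensor_factors K Y "\<lambda>x c. c \<odot>\<^bsub>Y\<^esub> x" Y' by (rule ktensor_factors[OF Y Y'])
  interpret TZ: tensor_factors K Z "\<lambda>x c. c \<odot>\<^bsub>Z\<^esub> x" Z' by (rule ktensor_factors[OF Z Z'])
  note pl = p[unfolded kbilinear_def, THEN conjunct1, rule_format]
    and pr = p[unfolded kbilinear_def, THEN conjunct2, rule_format]
    and ql = q[unfolded kbilinear_def, THEN conjunct1, rule_format]
    and qr = q[unfolded kbilinear_def, THEN conjunct2, rule_format]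
  define U where "U = (\<lambda>x x'. tlift TZ.T (\<lambda>y y'. TZ.pure (p x y) (q x' y')))"
  have Ubal: "balanced K Y (\<lambda>x c. c \<odot>\<^bsub>Y\<^esub> x) Y' TZ.T (\<lambda>y y'. TZ.pure (p x y) (q x' y'))"
    if "x \<in> carrier X" "x' \<in> carrier X'" for x x'
    by (rule ktensor_map_balanced[OF Z Z' pl[OF that(1)] ql[OF that(2)]])
  have Uhom: "U x x' \<in> add_hom TY.T TZ.T" if "x \<in> carrier X" "x' \<in> carrier X'" for x x'
    unfolding U_def by (rule TY.tlift_hom[OF TZ.abelian_group_tensor Ubal[OF that]])
  have Upure: "U x x' (TY.pure y y') = TZ.pure (p x y) (q x' y')"
    if "x \<in> carrier X" "x' \<in> carrier X'" "y \<in> carrier Y" "y' \<in> carrier Y'" for x x' y y'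
    unfolding U_def by (rule TY.tlift_pure[OF TZ.abelian_group_tensor Ubal[OF that(1,2)] that(3,4)])
  \<comment> \<open>Each condition on \<open>U x x' t\<close> is linear in \<open>t\<close>, hence follows from the case of a pure tensor \<open>t\<close>.\<close>
  have bal: "balanced K X (\<lambda>x c. c \<odot>\<^bsub>X\<^esub> x) X' TZ.T (\<lambda>x x'. U x x' t)" if t: "t \<in> carrier TY.T" for t
  proof (rule balancedI)
    fix x assume x: "x \<in> carrier X"
    show "(\<lambda>x'. U x x' t) \<in> add_hom X' TZ.T"
    proof (rule TY.tensor_family_hom[OF TX.Y.a_closed TZ.abelian_group_tensor Uhom[OF x] _ t])
      fix y y' assume y: "y \<in> carrier Y" "y' \<in> carrier Y'"
      have "(\<lambda>x'. TZ.pure (p x y) (q x' y')) \<in> add_hom X' TZ.T"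
        by (rule add_hom_comp[OF lmod_homD(1)[OF qr[OF y(2)]]
              TZ.pure_hom_right[OF lmod_homD(2)[OF pl[OF x] y(1)]]])
      then show "(\<lambda>x'. U x x' (TY.pure y y')) \<in> add_hom X' TZ.T"
        by (rule add_hom_cong[OF TX.Y.abelian_group_axioms]) (simp add: Upure x y)
    qed
  next
    fix x' assume x': "x' \<in> carrier X'"
    show "(\<lambda>x. U x x' t) \<in> add_hom X TZ.T"
    proof (rule TY.tensor_family_hom[OF TX.X.a_closed TZ.abelian_group_tensor Uhom[OF _ x'] _ t])
      fix y y' assume y: "y \<in> carrier Y" "y' \<in> carrier Y'"
      have "(\<lambda>x. TZ.pure (p x y) (q x' y')) \<in> add_hom X TZ.T"
        by (rule add_hom_comp[OF lmod_homD(1)[OF pr[OF y(1)]]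
              TZ.pure_hom_left[OF lmod_homD(2)[OF ql[OF x'] y(2)]]])
      then show "(\<lambda>x. U x x' (TY.pure y y')) \<in> add_hom X TZ.T"
        by (rule add_hom_cong[OF TX.X.abelian_group_axioms]) (simp add: Upure x' y)
    qed
  next
    fix x c x' assume x: "x \<in> carrier X" and c: "c \<in> carrier K" and x': "x' \<in> carrier X'"
    show "U (c \<odot>\<^bsub>X\<^esub> x) x' t = U x (c \<odot>\<^bsub>X'\<^esub> x') t"
    proof (rule TY.tensor_hom_eq[OF Uhom[OF TX.xr_closed[OF x c] x'] Uhom[OF x TX.yl_closed[OF c x']] _ t])
      fix y y' assume y: "y \<in> carrier Y" "y' \<in> carrier Y'"
      then show "U (c \<odot>\<^bsub>X\<^esub> x) x' (TY.pure y y') = U x (c \<odot>\<^bsub>X'\<^esub> x') (TY.pure y y')"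
        using x c x' TX.xr_closed[OF x c] TX.yl_closed[OF c x']
          lmod_homD(3)[OF pr[OF y(1)] c x] lmod_homD(3)[OF qr[OF y(2)] c x']
          TZ.pure_balanced[OF lmod_homD(2)[OF pl[OF x] y(1)] c lmod_homD(2)[OF ql[OF x'] y(2)]]
        by (simp add: Upure)
    qed
  qed
  have kU: "kmap2 K Z Z' p q s t = tlift TZ.T (\<lambda>x x'. U x x' t) s" for s t
    by (simp add: kmap2_def U_def)
  show left: "(\<lambda>s. kmap2 K Z Z' p q s t) \<in> add_hom TX.T TZ.T" if "t \<in> carrier TY.T" for t
    unfolding kU by (rule TX.tlift_hom[OF TZ.abelian_group_tensor bal[OF that]])
  have kp: "kmap2 K Z Z' p q (TX.pure x x') t = U x x' t"
    if "x \<in> carrier X" "x' \<in> carrier X'" "t \<in> carrier TY.T" for x x' t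
    unfolding kU using TX.tlift_pure[OF TZ.abelian_group_tensor bal[OF that(3)] that(1,2)] .
  show "kmap2 K Z Z' p q s \<in> add_hom TY.T TZ.T" if "s \<in> carrier TX.T" for s
  proof (rule TX.tensor_family_hom[OF TY.T.a_closed TZ.abelian_group_tensor left _ that])
    fix x x' assume x: "x \<in> carrier X" "x' \<in> carrier X'"
    show "(\<lambda>t. kmap2 K Z Z' p q (TX.pure x x') t) \<in> add_hom TY.T TZ.T"
      by (rule add_hom_cong[OF TY.abelian_group_tensor Uhom[OF x]]) (simp add: kp x)
  qed
  show "kmap2 K Z Z' p q (TX.pure x x') (TY.pure y y') = TZ.pure (p x y) (q x' y')"
    if "x \<in> carrier X" "x' \<in> carrier X'" "y \<in> carrier Y" "y' \<in> carrier Y'" for x x' y y'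
    using that by (simp add: kp Upure)
qed

section \<open>Semilinear maps and extension of scalars\<close>

text \<open>These semilinear maps stand for the linear maps from \<open>M\<close> to the restriction of \<open>N\<close>
  along \<open>f\<close>, without introducing the restricted module.\<close>

definition slin ::
  "('a, 'c) ring_scheme \<Rightarrow> ('a \<Rightarrow> 'a') \<Rightarrow> ('a, 'm, 'd) module_scheme \<Rightarrow>
   ('a', 'n, 'e) module_scheme \<Rightarrow> ('m \<Rightarrow> 'n) set"
  where "slin A f M N =
    {h \<in> add_hom M N. \<forall>a \<in> carrier A. \<forall>m \<in> carrier M. h (a \<odot>\<^bsub>M\<^esub> m) = f a \<odot>\<^bsub>N\<^esub> h m}"

lemma lmod_hom_eq_slin: "lmod_hom R M N = slin R (\<lambda>r. r) M N"
  by (simp add: lmod_hom_def slin_def hom_add_monoid)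

lemma slinI:
  assumes "h \<in> add_hom M N"
    and "\<And>a m. \<lbrakk>a \<in> carrier A; m \<in> carrier M\<rbrakk> \<Longrightarrow> h (a \<odot>\<^bsub>M\<^esub> m) = f a \<odot>\<^bsub>N\<^esub> h m"
  shows "h \<in> slin A f M N"
  using assms by (simp add: slin_def)

lemma slinD:
  assumes "h \<in> slin A f M N"
  shows "h \<in> add_hom M N"
    and "m \<in> carrier M \<Longrightarrow> h m \<in> carrier N"
    and "\<lbrakk>a \<in> carrier A; m \<in> carrier M\<rbrakk> \<Longrightarrow> h (a \<odot>\<^bsub>M\<^esub> m) = f a \<odot>\<^bsub>N\<^esub> h m"
  using assms by (auto simp: slin_def add_hom_def)

lemma slin_comp:
  assumes h: "h \<in> slin A f M N" and k: "k \<in> slin A' g N P"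
    and "\<And>a. a \<in> carrier A \<Longrightarrow> f a \<in> carrier A'"
    and "\<And>a. a \<in> carrier A \<Longrightarrow> g (f a) = gf a"
  shows "(\<lambda>m. k (h m)) \<in> slin A gf M P"
  using assms by (intro slinI add_hom_comp[OF slinD(1)[OF h] slinD(1)[OF k]])
    (simp add: slinD[OF h] slinD[OF k])

lemma slin_cong:
  assumes M: "left_module A M" and h: "h \<in> slin A f M N"
    and eq: "\<And>m. m \<in> carrier M \<Longrightarrow> h' m = h m"
  shows "h' \<in> slin A f M N"
proof -
  interpret left_module A M by fact
  have "abelian_group M" by unfold_locales
  from add_hom_cong[OF this slinD(1)[OF h], of h'] eq
  show ?thesis using slinD[OF h] by (intro slinI) (auto simp: lsmult_closed)
qed

lemma lmod_hom_comp:
  "\<lbrakk>h \<in> lmod_hom R M N; k \<in> lmod_hom R N P\<rbrakk> \<Longrightarrow> (\<lambda>m. k (h m)) \<in> lmod_hom R M P"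
  unfolding lmod_hom_eq_slin by (rule slin_comp) auto

lemma lmod_hom_o: "\<lbrakk>h \<in> lmod_hom R L M; k \<in> lmod_hom R M N\<rbrakk> \<Longrightarrow> k \<circ> h \<in> lmod_hom R L N"
  using lmod_hom_comp by (fastforce simp: comp_def)

lemma lmod_hom_id: "(\<lambda>m. m) \<in> lmod_hom R M M"
  by (auto simp: lmod_hom_def hom_def)

lemma left_module_facts:
  assumes "left_module R M"
  shows "ring R" and "abelian_group M"
  using assms by (auto simp: left_module_def)

lemma as_module_sel [simp]:
  "carrier (as_module A s) = carrier A" "add (as_module A s) = add A"
  "\<zero>\<^bsub>as_module A s\<^esub> = \<zero>\<^bsub>A\<^esub>" "module.smult (as_module A s) = s"
  "monoid.mult (as_module A s) = monoid.mult A" "\<one>\<^bsub>as_module A s\<^esub> = \<one>\<^bsub>A\<^esub>"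
  by (simp_all add: as_module_def)

lemma abelian_group_as_module: "abelian_group A \<Longrightarrow> abelian_group (as_module A s)"
  by (rule abelian_group_transfer) simp_all

lemma ext_sel [simp]:
  "carrier (ext A f A' M) = carrier (ext_tensor A f A' M)"
  "add (ext A f A' M) = add (ext_tensor A f A' M)"
  "\<zero>\<^bsub>ext A f A' M\<^esub> = \<zero>\<^bsub>ext_tensor A f A' M\<^esub>"
  by (simp_all add: ext_def Let_def)

lemma add_hom_ext [simp]:
  "add_hom (ext A f A' M) Z = add_hom (ext_tensor A f A' M) Z"
  "add_hom Z (ext A f A' M) = add_hom Z (ext_tensor A f A' M)"
  by (simp_all add: add_hom_def)

lemma ext_smult:
  "c \<odot>\<^bsub>ext A f A' M\<^esub> t =
    tlift (ext_tensor A f A' M) (\<lambda>a' m. ext_pure A f A' M (c \<otimes>\<^bsub>A'\<^esub> a') m) t"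
  by (simp add: ext_def Let_def)

text \<open>The \<open>g\<close>-semilinear extension to \<open>f\<^sup>* M\<close> of a map that is semilinear over \<open>g \<circ> f\<close>. The case \<open>g = id\<close> is
  the universal property of \<open>f\<^sup>* M\<close>; the inner of two successive extensions, as in \<open>can\<close>, has a general \<open>g\<close>.\<close>

definition ext_lift ::
  "('a' \<Rightarrow> 'a'') \<Rightarrow> ('a'', 'n) module \<Rightarrow> ('m \<Rightarrow> 'n) \<Rightarrow> ('a', 'm) tensor \<Rightarrow> 'n"
  where "ext_lift g N h = tlift N (\<lambda>a' m. g a' \<odot>\<^bsub>N\<^esub> h m)"

locale scalar_extension = A: ring A + A': ring A' + M: left_module A M
  for A :: "('a, 'c) ring_scheme" and f :: "'a \<Rightarrow> 'a'" and A' :: "('a', 'd) ring_scheme"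
    and M :: "('a, 'm) module" +
  assumes f: "f \<in> ring_hom A A'"
begin

lemma factors: "tensor_factors A A' (\<lambda>a' a. a' \<otimes>\<^bsub>A'\<^esub> f a) M"
  using ring_hom_closed[OF f] M.lsmult_closed
  by (unfold_locales) (auto)

sublocale tensor_factors A A' "\<lambda>a' a. a' \<otimes>\<^bsub>A'\<^esub> f a" M by (rule factors)

abbreviation "fM \<equiv> ext A f A' M"
abbreviation "\<eta> \<equiv> \<lambda>m. pure \<one>\<^bsub>A'\<^esub> m"

lemma abelian_group_ext: "abelian_group fM"
  by (rule abelian_group_transfer[OF abelian_group_tensor]) simp_all

lemma smult_balanced:
  assumes "c \<in> carrier A'"
  shows "balanced A A' (\<lambda>a' a. a' \<otimes>\<^bsub>A'\<^esub> f a) M T (\<lambda>a' m. pure (c \<otimes>\<^bsub>A'\<^esub> a') m)"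
proof (rule balancedI)
  show "pure (c \<otimes>\<^bsub>A'\<^esub> a') \<in> add_hom M T" if "a' \<in> carrier A'" for a'
    using assms that by (intro pure_hom_right) simp
  have "(\<lambda>a'. c \<otimes>\<^bsub>A'\<^esub> a') \<in> add_hom A' A'" using assms by (intro add_homI) (auto simp: A'.r_distr)
  then show "(\<lambda>a'. pure (c \<otimes>\<^bsub>A'\<^esub> a') m) \<in> add_hom A' T" if "m \<in> carrier M" for m
    by (rule add_hom_comp[OF _ pure_hom_left[OF that]])
  show "pure (c \<otimes>\<^bsub>A'\<^esub> (a' \<otimes>\<^bsub>A'\<^esub> f a)) m = pure (c \<otimes>\<^bsub>A'\<^esub> a') (a \<odot>\<^bsub>M\<^esub> m)"
    if "a' \<in> carrier A'" "a \<in> carrier A" "m \<in> carrier M" for a' a m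
    using that assms pure_balanced[of "c \<otimes>\<^bsub>A'\<^esub> a'" a m] ring_hom_closed[OF f, of a]
    by (simp add: A'.m_assoc)
qed

lemma smult_hom: "c \<in> carrier A' \<Longrightarrow> (\<lambda>t. c \<odot>\<^bsub>fM\<^esub> t) \<in> add_hom T T"
  unfolding ext_smult by (rule tlift_hom[OF abelian_group_tensor smult_balanced])

lemma smult_pure:
  "\<lbrakk>c \<in> carrier A'; a' \<in> carrier A'; m \<in> carrier M\<rbrakk>
    \<Longrightarrow> c \<odot>\<^bsub>fM\<^esub> pure a' m = pure (c \<otimes>\<^bsub>A'\<^esub> a') m"
  unfolding ext_smult by (rule tlift_pure[OF abelian_group_tensor smult_balanced])

lemma pure_eq_smult: "\<lbrakk>a' \<in> carrier A'; m \<in> carrier M\<rbrakk> \<Longrightarrow> pure a' m = a' \<odot>\<^bsub>fM\<^esub> \<eta> m"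
  by (simp add: smult_pure)

lemma left_module_ext: "left_module A' fM"
proof -
  note cl = add_hom_closed[OF smult_hom] and sadd = add_hom_add[OF smult_hom]
  interpret fM: abelian_group fM by (rule abelian_group_ext)
  show ?thesis
  proof (unfold_locales, simp_all add: cl sadd)
    show "(a \<oplus>\<^bsub>A'\<^esub> b) \<odot>\<^bsub>fM\<^esub> t = a \<odot>\<^bsub>fM\<^esub> t \<oplus>\<^bsub>T\<^esub> b \<odot>\<^bsub>fM\<^esub> t"
      if "a \<in> carrier A'" "b \<in> carrier A'" "t \<in> carrier T" for a b t
      using that(3)
    proof (induction rule: tensor_induct)
      case (pure x y)
      then show ?case
        using that(1,2) add_hom_add[OF pure_hom_left[of y]] by (simp add: smult_pure A'.l_distr)
    next
      case (add s t)
      then show ?case using that(1,2) by (simp add: cl sadd T.a_ac)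
    qed
    show "(a \<otimes>\<^bsub>A'\<^esub> b) \<odot>\<^bsub>fM\<^esub> t = a \<odot>\<^bsub>fM\<^esub> (b \<odot>\<^bsub>fM\<^esub> t)"
      if "a \<in> carrier A'" "b \<in> carrier A'" "t \<in> carrier T" for a b t
      using that(3)
      by (induction rule: tensor_induct)
        (use that(1,2) in \<open>simp_all add: smult_pure A'.m_assoc cl sadd\<close>)
    show "\<one>\<^bsub>A'\<^esub> \<odot>\<^bsub>fM\<^esub> t = t" if "t \<in> carrier T" for t
      using that by (induction rule: tensor_induct) (simp_all add: smult_pure sadd)
  qed
qed

lemma unit_slin: "\<eta> \<in> slin A f M fM"
  using pure_hom_right[OF A'.one_closed] pure_balanced[OF A'.one_closed, symmetric]
    ring_hom_closed[OF f]
  by (intro slinI) (simp_all add: pure_eq_smult[symmetric])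

text \<open>As \<open>a' \<otimes> m = a' (1 \<otimes> m)\<close>, the elements \<open>1 \<otimes> m\<close> generate \<open>f\<^sup>* M\<close>.\<close>

lemma ext_hom_eq:
  assumes N: "left_module A'' N" and u: "u \<in> slin A' g fM N" and v: "v \<in> slin A' g fM N"
    and eq: "\<And>m. m \<in> carrier M \<Longrightarrow> u (\<eta> m) = v (\<eta> m)" and t: "t \<in> carrier fM"
  shows "u t = v t"
proof (rule tensor_hom_eq)
  show "u \<in> add_hom T N" "v \<in> add_hom T N" using slinD(1)[OF u] slinD(1)[OF v] by simp_all
  show "u (pure a' m) = v (pure a' m)" if "a' \<in> carrier A'" "m \<in> carrier M" for a' m
    unfolding pure_eq_smult[OF that] using that by (simp add: slinD(3)[OF u] slinD(3)[OF v] eq)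
qed (use t in simp)

context
  fixes A'' :: "('a'', 'g) ring_scheme" and g and N :: "('a'', 'n) module" and h
  assumes N: "left_module A'' N" and g: "g \<in> ring_hom A' A''"
    and h: "h \<in> slin A (g \<circ> f) M N"
begin

lemma ext_lift_balanced:
  "balanced A A' (\<lambda>a' a. a' \<otimes>\<^bsub>A'\<^esub> f a) M N (\<lambda>a' m. g a' \<odot>\<^bsub>N\<^esub> h m)"
proof -
  interpret N: left_module A'' N by (rule N)
  note cl = ring_hom_closed[OF f] ring_hom_closed[OF g] slinD(2)[OF h]
  show ?thesis
  proof (intro balancedI add_homI)
    show "g (a' \<otimes>\<^bsub>A'\<^esub> f a) \<odot>\<^bsub>N\<^esub> h m = g a' \<odot>\<^bsub>N\<^esub> h (a \<odot>\<^bsub>M\<^esub> m)"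
      if "a' \<in> carrier A'" "a \<in> carrier A" "m \<in> carrier M" for a' a m
      using that by (simp add: cl slinD(3)[OF h] N.lsmult_assoc ring_hom_mult[OF g])
  qed (simp_all add: cl N.lsmult_closed N.lsmult_l_distr N.lsmult_r_distr ring_hom_add[OF g]
      add_hom_add[OF slinD(1)[OF h]])
qed

lemma ext_lift_pure:
  "\<lbrakk>a' \<in> carrier A'; m \<in> carrier M\<rbrakk> \<Longrightarrow> ext_lift g N h (pure a' m) = g a' \<odot>\<^bsub>N\<^esub> h m"
  unfolding ext_lift_def by (rule tlift_pure[OF left_module_facts(2)[OF N] ext_lift_balanced])

lemma ext_lift_unit: "m \<in> carrier M \<Longrightarrow> ext_lift g N h (\<eta> m) = h m"
  using ring_hom_one[OF g] slinD(2)[OF h] left_module.lsmult_one[OF N] by (simp add: ext_lift_pure)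

lemma ext_lift_slin: "ext_lift g N h \<in> slin A' g fM N"
proof (rule slinI)
  interpret N: left_module A'' N by (rule N)
  have hom: "ext_lift g N h \<in> add_hom T N"
    unfolding ext_lift_def by (rule tlift_hom[OF left_module_facts(2)[OF N] ext_lift_balanced])
  then show "ext_lift g N h \<in> add_hom fM N" by simp
  note cl = ring_hom_closed[OF g] slinD(2)[OF h] add_hom_closed[OF hom]
    add_hom_closed[OF smult_hom]
  show "ext_lift g N h (c \<odot>\<^bsub>fM\<^esub> t) = g c \<odot>\<^bsub>N\<^esub> ext_lift g N h t"
    if c: "c \<in> carrier A'" and t: "t \<in> carrier fM" for c t
    using t[simplified]
  proof (induction rule: tensor_induct)
    case (pure x y)
    then show ?case using c by (simp add: smult_pure ext_lift_pure N.lsmult_assoc cl ring_hom_mult[OF g])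
  next
    case (add s t)
    then show ?case
      using c by (simp add: add_hom_add[OF smult_hom] add_hom_add[OF hom] cl N.lsmult_r_distr)
  qed
qed

text \<open>The maps in the definitions of \<open>ext_map\<close>, \<open>can\<close> and \<open>alpha\<close> are all of this kind.\<close>

lemma tlift_eq_ext_lift:
  assumes "\<And>a' m. \<lbrakk>a' \<in> carrier A'; m \<in> carrier M\<rbrakk> \<Longrightarrow> \<beta> a' m = g a' \<odot>\<^bsub>N\<^esub> h m"
    and "t \<in> carrier fM"
  shows "tlift N \<beta> t = ext_lift g N h t"
  unfolding ext_lift_def
  by (rule tlift_cong) (use assms balancedD(4)[OF ext_lift_balanced] left_module_facts(2)[OF N] in auto)

end

end

lemma ring_hom_id: "(\<lambda>x. x) \<in> ring_hom A A"
  by (auto simp: ring_hom_def)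

lemma scalar_extensionI:
  "\<lbrakk>f \<in> ring_hom A A'; ring A'; left_module A M\<rbrakk> \<Longrightarrow> scalar_extension A f A' M"
  by (simp add: scalar_extension_def scalar_extension_axioms_def left_module_facts)

lemma (in scalar_extension) ext_map:
  assumes N: "left_module A N" and h: "h \<in> lmod_hom A M N"
  shows ext_map_hom: "ext_map A f A' N h \<in> lmod_hom A' fM (ext A f A' N)"
    and ext_map_unit: "m \<in> carrier M \<Longrightarrow>
      ext_map A f A' N h (\<eta> m) = ext_pure A f A' N \<one>\<^bsub>A'\<^esub> (h m)"
proof -
  interpret N: scalar_extension A f A' N by (rule scalar_extensionI[OF f A'.ring_axioms N])
  have hs: "(\<lambda>m. N.\<eta> (h m)) \<in> slin A ((\<lambda>x. x) \<circ> f) M N.fM"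
    by (rule slin_comp[OF h[unfolded lmod_hom_eq_slin] N.unit_slin]) simp_all
  have eq: "ext_map A f A' N h t = ext_lift (\<lambda>x. x) N.fM (\<lambda>m. N.\<eta> (h m)) t" if "t \<in> carrier fM" for t
    unfolding ext_map_def
    by (rule tlift_eq_ext_lift[OF N.left_module_ext ring_hom_id hs _ that])
       (simp add: N.pure_eq_smult[symmetric] lmod_homD(2)[OF h])
  show "ext_map A f A' N h \<in> lmod_hom A' fM (ext A f A' N)"
    unfolding lmod_hom_eq_slin
    by (rule slin_cong[OF left_module_ext ext_lift_slin[OF N.left_module_ext ring_hom_id hs] eq])
  show "m \<in> carrier M \<Longrightarrow> ext_map A f A' N h (\<eta> m) = ext_pure A f A' N \<one>\<^bsub>A'\<^esub> (h m)"
    using eq[of "\<eta> m"] ext_lift_unit[OF N.left_module_ext ring_hom_id hs] by simp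
qed

locale scalar_extension2 = S1: scalar_extension A f A' M + A'': ring A''
  for A :: "('a, 'c) ring_scheme" and f :: "'a \<Rightarrow> 'a'" and A' :: "('a', 'd) ring_scheme"
    and M :: "('a, 'm) module" and g :: "'a' \<Rightarrow> 'a''" and A'' :: "('a'', 'e) ring_scheme" +
  assumes g: "g \<in> ring_hom A' A''"
begin

lemma gf: "g \<circ> f \<in> ring_hom A A''" by (rule ring_hom_trans[OF S1.f g])

sublocale S2: scalar_extension A' g A'' "ext A f A' M"
  by (rule scalar_extensionI[OF g A''.ring_axioms S1.left_module_ext])

sublocale S3: scalar_extension A "g \<circ> f" A'' M
  by (rule scalar_extensionI[OF gf A''.ring_axioms]) unfold_locales

text \<open>The uniqueness principle twice, first for the outer and then for the inner extension.\<close>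

lemma ext_ext_hom_eq:
  assumes N: "left_module A'' N" and u: "u \<in> lmod_hom A'' S2.fM N" and v: "v \<in> lmod_hom A'' S2.fM N"
    and eq: "\<And>m. m \<in> carrier M \<Longrightarrow> u (S2.\<eta> (S1.\<eta> m)) = v (S2.\<eta> (S1.\<eta> m))"
    and t: "t \<in> carrier S2.fM"
  shows "u t = v t"
proof (rule S2.ext_hom_eq[OF N u[unfolded lmod_hom_eq_slin] v[unfolded lmod_hom_eq_slin] _ t])
  have "(\<lambda>x. w (S2.\<eta> x)) \<in> slin A' g S1.fM N" if "w \<in> lmod_hom A'' S2.fM N" for w
    by (rule slin_comp[OF S2.unit_slin that[unfolded lmod_hom_eq_slin]]) (simp_all add: ring_hom_closed[OF g])
  from S1.ext_hom_eq[OF N this[OF u] this[OF v], OF eq]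
  show "u (S2.\<eta> x) = v (S2.\<eta> x)" if "x \<in> carrier S1.fM" for x using that by blast
qed

lemma unit_unit_slin: "(\<lambda>m. S2.\<eta> (S1.\<eta> m)) \<in> slin A (g \<circ> f) M S2.fM"
  by (rule slin_comp[OF S1.unit_slin S2.unit_slin]) (simp_all add: ring_hom_closed[OF S1.f])

text \<open>The inner \<open>tlift\<close> in the definition of \<open>can\<close> is \<open>a''\<close> times the \<open>g\<close>-semilinear extension of the unit \<open>M \<rightarrow> (g f)\<^sup>* M\<close>,
  so that \<open>can\<close> is the extension of an extension.\<close>

lemma can:
  shows can_hom: "can A f g A'' M \<in> lmod_hom A'' S2.fM S3.fM"
    and can_unit: "m \<in> carrier M \<Longrightarrow> can A f g A'' M (S2.\<eta> (S1.\<eta> m)) = S3.\<eta> m"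
proof -
  interpret Z: left_module A'' S3.fM by (rule S3.left_module_ext)
  let ?h = "ext_lift g S3.fM S3.\<eta>"
  note hl = S3.left_module_ext g S3.unit_slin
  note ag = left_module_facts(2)[OF S3.left_module_ext]
  have h: "?h \<in> slin A' ((\<lambda>x. x) \<circ> g) S1.fM S3.fM"
    using S1.ext_lift_slin[OF hl] by (simp add: comp_def)
  note hl2 = S3.left_module_ext ring_hom_id h
  have inner: "tlift S3.fM (\<lambda>a' m. S3.pure (a'' \<otimes>\<^bsub>A''\<^esub> g a') m) t = a'' \<odot>\<^bsub>S3.fM\<^esub> ?h t"
    if a: "a'' \<in> carrier A''" and t: "t \<in> carrier S1.fM" for a'' t
  proof -
    have "a'' \<odot>\<^bsub>S3.fM\<^esub> ?h t = tlift S3.fM (\<lambda>a' m. a'' \<odot>\<^bsub>S3.fM\<^esub> (g a' \<odot>\<^bsub>S3.fM\<^esub> S3.\<eta> m)) t"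
      unfolding ext_lift_def
    proof (rule S1.tlift_comp[OF ag ag S1.ext_lift_balanced[OF hl]])
      show "(\<lambda>t. a'' \<odot>\<^bsub>S3.fM\<^esub> t) \<in> add_hom S3.fM S3.fM" using S3.smult_hom[OF a] by simp
      show "t \<in> carrier S1.T" using t by simp
    qed
    also have "\<dots> = tlift S3.fM (\<lambda>a' m. S3.pure (a'' \<otimes>\<^bsub>A''\<^esub> g a') m) t"
      by (rule S1.tlift_cong[OF ag]) (use t a in \<open>simp_all add: S3.smult_pure ring_hom_closed[OF g] del: o_apply\<close>)
    finally show ?thesis by simp
  qed
  have eq: "can A f g A'' M t = ext_lift (\<lambda>x. x) S3.fM ?h t" if "t \<in> carrier S2.fM" for t
    unfolding can_def Let_def
    by (rule S2.tlift_eq_ext_lift[OF hl2 _ that]) (rule inner)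
  show "can A f g A'' M \<in> lmod_hom A'' S2.fM S3.fM"
    unfolding lmod_hom_eq_slin
    by (rule slin_cong[OF S2.left_module_ext S2.ext_lift_slin[OF hl2] eq])
  show "can A f g A'' M (S2.\<eta> (S1.\<eta> m)) = S3.\<eta> m" if "m \<in> carrier M"
    using eq[of "S2.\<eta> (S1.\<eta> m)"] S2.ext_lift_unit[OF hl2, of "S1.\<eta> m"] S1.ext_lift_unit[OF hl that] that
    by simp
qed

text \<open>The inverse is the linear extension of \<open>m \<mapsto> 1 \<otimes> (1 \<otimes> m)\<close>.\<close>

lemma can_iso: "can A f g A'' M \<in> lmod_iso A'' S2.fM S3.fM"
proof -
  have h: "(\<lambda>m. S2.\<eta> (S1.\<eta> m)) \<in> slin A ((\<lambda>x. x) \<circ> (g \<circ> f)) M S2.fM"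
    using unit_unit_slin by (simp add: comp_def)
  note hl = S2.left_module_ext ring_hom_id h
  let ?c = "can A f g A'' M" and ?d = "ext_lift (\<lambda>x. x) S2.fM (\<lambda>m. S2.\<eta> (S1.\<eta> m))"
  have d: "?d \<in> lmod_hom A'' S3.fM S2.fM"
    unfolding lmod_hom_eq_slin by (rule S3.ext_lift_slin[OF hl])
  note du = S3.ext_lift_unit[OF hl]
  have dc: "?d (?c t) = t" if "t \<in> carrier S2.fM" for t
    by (rule ext_ext_hom_eq[OF S2.left_module_ext lmod_hom_comp[OF can_hom d] lmod_hom_id _ that])
       (simp add: can_unit du del: o_apply)
  have cd: "?c (?d t) = t" if "t \<in> carrier S3.fM" for t
    by (rule S3.ext_hom_eq[OF S3.left_module_ext lmod_hom_comp[OF d can_hom, unfolded lmod_hom_eq_slin]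
          lmod_hom_id[unfolded lmod_hom_eq_slin] _ that])
       (simp add: can_unit du del: o_apply)
  have "bij_betw ?c (carrier S2.fM) (carrier S3.fM)"
    by (rule bij_betw_byWitness[where f' = ?d])
       (use dc cd lmod_homD(2)[OF can_hom] lmod_homD(2)[OF d] in auto)
  then show ?thesis using can_hom by (simp add: lmod_iso_def)
qed

end

section \<open>The diagonal action\<close>

lemma restrict_base_sel [simp]:
  "carrier (restrict_base A M) = carrier M" "add (restrict_base A M) = add M"
  "\<zero>\<^bsub>restrict_base A M\<^esub> = \<zero>\<^bsub>M\<^esub>"
  by (simp_all add: restrict_base_def)

lemma restrict_base_smult:
  "c \<odot>\<^bsub>restrict_base A M\<^esub> m = (c \<odot>\<^bsub>A\<^esub> \<one>\<^bsub>A\<^esub>) \<odot>\<^bsub>M\<^esub> m"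
  by (simp add: restrict_base_def)

context assoc_algebra
begin

lemma closed_action_algebra: "closed_action K A"
  unfolding closed_action_def using smult_closed abelian_group_axioms by blast

lemma closed_action_restrict: "left_module A M \<Longrightarrow> closed_action K (restrict_base A M)"
  using left_module_facts(2)[of A M] left_module.lsmult_closed[of A M]
  by (auto simp: closed_action_def restrict_base_smult intro: abelian_group_transfer)

lemma smult_one_mult: "\<lbrakk>c \<in> carrier K; a \<in> carrier A\<rbrakk> \<Longrightarrow> (c \<odot>\<^bsub>A\<^esub> \<one>\<^bsub>A\<^esub>) \<otimes>\<^bsub>A\<^esub> a = c \<odot>\<^bsub>A\<^esub> a"
  and mult_smult_one: "\<lbrakk>c \<in> carrier K; a \<in> carrier A\<rbrakk> \<Longrightarrow> a \<otimes>\<^bsub>A\<^esub> (c \<odot>\<^bsub>A\<^esub> \<one>\<^bsub>A\<^esub>) = c \<odot>\<^bsub>A\<^esub> a"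
  by (simp_all add: asmult_left asmult_right)

lemma kbilinear_mult: "kbilinear K A A A (monoid.mult A)"
  unfolding kbilinear_def
  by (auto intro!: lmod_homI simp: l_distr r_distr asmult_left asmult_right)

lemma kbilinear_action:
  assumes "left_module A M"
  shows "kbilinear K (restrict_base A M) A (restrict_base A M) (\<lambda>m a. a \<odot>\<^bsub>M\<^esub> m)"
proof -
  interpret M: left_module A M by fact
  show ?thesis
    unfolding kbilinear_def
    by (auto intro!: lmod_homI simp: restrict_base_smult M.lsmult_closed M.lsmult_l_distr M.lsmult_r_distr
        M.lsmult_assoc[symmetric] smult_one_mult mult_smult_one)
qed

end

lemma alg_homD:
  assumes "f \<in> alg_hom K A A'"
  shows "f \<in> ring_hom A A'" and "f \<in> lmod_hom K A A'"
  using assms by (auto simp: alg_hom_def ring_hom_def intro: lmod_homI)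

text \<open>A \<open>K\<close>-algebra map preserves the scalars \<open>c \<cdot> 1\<close>, through which \<open>K\<close> acts on modules.\<close>

lemma slin_restrict:
  assumes A: "assoc_algebra K A" and A': "assoc_algebra K A'" and f: "f \<in> alg_hom K A A'"
    and h: "h \<in> slin A f M M'"
  shows "h \<in> lmod_hom K (restrict_base A M) (restrict_base A' M')"
proof -
  interpret A: assoc_algebra K A by fact
  interpret A': assoc_algebra K A' by fact
  have "f (c \<odot>\<^bsub>A\<^esub> \<one>\<^bsub>A\<^esub>) = c \<odot>\<^bsub>A'\<^esub> \<one>\<^bsub>A'\<^esub>" if "c \<in> carrier K" for c
    using f that ring_hom_one[of f A A'] by (simp add: alg_hom_def)
  then show ?thesis
    by (intro lmod_homI) (simp_all add: restrict_base_smult slinD[OF h] add_hom_add[OF slinD(1)[OF h]])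
qed

lemma alg_tensor_sel [simp]:
  "carrier (alg_tensor K A B) = carrier (ktensor K A B)"
  "add (alg_tensor K A B) = add (ktensor K A B)"
  "\<one>\<^bsub>alg_tensor K A B\<^esub> = kpure K A B \<one>\<^bsub>A\<^esub> \<one>\<^bsub>B\<^esub>"
  "s \<otimes>\<^bsub>alg_tensor K A B\<^esub> t = kmap2 K A B (monoid.mult A) (monoid.mult B) s t"
  by (simp_all add: alg_tensor_def Let_def kmap2_def)

abbreviation mtensor_base ::
  "('k, 'c) ring_scheme \<Rightarrow> ('k, 'b) bialgebra \<Rightarrow> ('k, 'e, 'b) comodule_algebra \<Rightarrow>
   ('e, 'm) module \<Rightarrow> ('b, 'q) module \<Rightarrow> ('m, 'q) tensor ring"
  where "mtensor_base K B E M Q \<equiv> ktensor K (restrict_base E M) (restrict_base B Q)"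

text \<open>The action of \<open>E \<otimes> B\<close> on \<open>M \<otimes> Q\<close>, of which the diagonal action is the
  restriction along the coaction.\<close>

definition tensor_act ::
  "('k, 'c) ring_scheme \<Rightarrow> ('k, 'b) bialgebra \<Rightarrow> ('k, 'e, 'b) comodule_algebra \<Rightarrow>
   ('e, 'm) module \<Rightarrow> ('b, 'q) module \<Rightarrow> ('e, 'b) tensor \<Rightarrow> ('m, 'q) tensor \<Rightarrow> ('m, 'q) tensor"
  where "tensor_act K B E M Q s x =
    kmap2 K (restrict_base E M) (restrict_base B Q) (\<lambda>m a. a \<odot>\<^bsub>M\<^esub> m) (\<lambda>q b. b \<odot>\<^bsub>Q\<^esub> q) x s"

lemma mtensor_sel [simp]:
  "carrier (mtensor K B E M Q) = carrier (mtensor_base K B E M Q)"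
  "add (mtensor K B E M Q) = add (mtensor_base K B E M Q)"
  "\<zero>\<^bsub>mtensor K B E M Q\<^esub> = \<zero>\<^bsub>mtensor_base K B E M Q\<^esub>"
  "e \<odot>\<^bsub>mtensor K B E M Q\<^esub> x = tensor_act K B E M Q (coact E e) x"
  by (simp_all add: mtensor_def Let_def tensor_act_def kmap2_def)

lemma add_hom_mtensor [simp]:
  "add_hom (mtensor K B E M Q) Z = add_hom (mtensor_base K B E M Q) Z"
  "add_hom Z (mtensor K B E M Q) = add_hom Z (mtensor_base K B E M Q)"
  by (simp_all add: add_hom_def)

lemma tlift_mtensor: "tlift (mtensor K B E M Q) = tlift (mtensor_base K B E M Q)"
  by (rule tlift_transfer) simp_all

locale diagonal = comodule_algebra K B E + M: left_module E M + Q: left_module B Q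
  for K :: "('k, 'c) ring_scheme" and B :: "('k, 'b) bialgebra"
    and E :: "('k, 'e, 'b) comodule_algebra" and M :: "('e, 'm) module" and Q :: "('b, 'q) module"
begin

lemmas actedM = E.closed_action_restrict[OF M.left_module_axioms]
  and actedQ = B.closed_action_restrict[OF Q.left_module_axioms]

sublocale MQ: tensor_factors K "restrict_base E M" "\<lambda>x c. c \<odot>\<^bsub>restrict_base E M\<^esub> x" "restrict_base B Q"
  by (rule ktensor_factors[OF actedM actedQ])

sublocale EB: tensor_factors K E "\<lambda>x c. c \<odot>\<^bsub>E\<^esub> x" B
  by (rule ktensor_factors[OF E.closed_action_algebra B.closed_action_algebra])

abbreviation "act \<equiv> tensor_act K B E M Q"

lemmas act_rules = actedM actedQ E.closed_action_algebra B.closed_action_algebra actedM actedQ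
  E.kbilinear_action[OF M.left_module_axioms] B.kbilinear_action[OF Q.left_module_axioms]

lemma act_hom_right: "s \<in> carrier EB.T \<Longrightarrow> act s \<in> add_hom MQ.T MQ.T"
  unfolding tensor_act_def by (rule kmap2_hom_left[OF act_rules])

lemma act_hom_left: "x \<in> carrier MQ.T \<Longrightarrow> (\<lambda>s. act s x) \<in> add_hom EB.T MQ.T"
  unfolding tensor_act_def using kmap2_hom_right[OF act_rules] by simp

lemma act_pure:
  "\<lbrakk>e \<in> carrier E; b \<in> carrier B; m \<in> carrier M; q \<in> carrier Q\<rbrakk>
    \<Longrightarrow> act (EB.pure e b) (MQ.pure m q) = MQ.pure (e \<odot>\<^bsub>M\<^esub> m) (b \<odot>\<^bsub>Q\<^esub> q)"
  unfolding tensor_act_def using kmap2_pure[OF act_rules, of m q e b] by simp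

lemmas act_simps = act_pure add_hom_add[OF act_hom_right] add_hom_add[OF act_hom_left]
  add_hom_closed[OF act_hom_right]

lemmas mult_rules = E.closed_action_algebra B.closed_action_algebra E.closed_action_algebra B.closed_action_algebra
  E.closed_action_algebra B.closed_action_algebra E.kbilinear_mult B.kbilinear_mult

lemmas mult_simps = kmap2_pure[OF mult_rules] add_hom_add[OF kmap2_hom_right[OF mult_rules]]
  add_hom_add[OF kmap2_hom_left[OF mult_rules]] add_hom_closed[OF kmap2_hom_right[OF mult_rules]]

lemma act_one: "x \<in> carrier MQ.T \<Longrightarrow> act (EB.pure \<one>\<^bsub>E\<^esub> \<one>\<^bsub>B\<^esub>) x = x"
  by (induction rule: MQ.tensor_induct) (simp_all add: act_simps M.lsmult_one Q.lsmult_one)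

lemma act_mult:
  assumes s: "s \<in> carrier EB.T" and t: "t \<in> carrier EB.T" and x: "x \<in> carrier MQ.T"
  shows "act (s \<otimes>\<^bsub>alg_tensor K E B\<^esub> t) x = act s (act t x)"
  using x
proof (induction rule: MQ.tensor_induct)
  case x: (pure m q)
  from t show ?case
  proof (induction rule: EB.tensor_induct)
    case t: (pure e b)
    from s show ?case
    proof (induction rule: EB.tensor_induct)
      case (pure e' b')
      then show ?case using x t
        by (simp add: act_simps mult_simps M.lsmult_assoc Q.lsmult_assoc M.lsmult_closed Q.lsmult_closed)
    next
      case (add s s')
      then show ?case using x t
        by (simp add: act_simps mult_simps M.lsmult_closed Q.lsmult_closed)
    qed
  next
    case (add t t')
    then show ?case using x s by (simp add: act_simps mult_simps)
  qed
next
  case (add x x')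
  then show ?case using s t by (simp add: act_simps mult_simps)
qed

lemma coact_ring_hom: "coact E \<in> ring_hom E (alg_tensor K E B)"
  by (rule alg_homD(1)[OF coact_hom])

lemma coact_closed: "e \<in> carrier E \<Longrightarrow> coact E e \<in> carrier EB.T"
  using ring_hom_closed[OF coact_ring_hom] by simp

text \<open>The unit law and associativity of the action are those of \<open>E \<otimes> B\<close>, transported along the algebra map
  \<open>\<rho>\<close>.\<close>

lemma left_module_mtensor: "left_module E (mtensor K B E M Q)"
proof -
  interpret T: abelian_group "mtensor K B E M Q"
    by (rule abelian_group_transfer[OF MQ.abelian_group_tensor]) simp_all
  show ?thesis
    by unfold_locales
      (simp_all add: coact_closed act_simps act_one act_mult[simplified]
        ring_hom_add[OF coact_ring_hom, simplified] ring_hom_mult[OF coact_ring_hom, simplified]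
        ring_hom_one[OF coact_ring_hom, simplified])
qed

lemma mtensor_hom_eq:
  assumes u: "u \<in> slin E f (mtensor K B E M Q) P" and v: "v \<in> slin E f (mtensor K B E M Q) P"
    and "\<And>m q. \<lbrakk>m \<in> carrier M; q \<in> carrier Q\<rbrakk> \<Longrightarrow> u (MQ.pure m q) = v (MQ.pure m q)"
    and "t \<in> carrier (mtensor K B E M Q)"
  shows "u t = v t"
  by (rule MQ.tensor_hom_eq) (use assms slinD(1)[OF u] slinD(1)[OF v] in auto)

end

section \<open>Maps of diagonal modules\<close>

text \<open>The pairs \<open>(f, \<phi>)\<close> over which the 2-cells are indexed. They include the identities, through which statements
  about \<open>E\<close>-linear maps become special cases of those about semilinear ones.\<close>

definition comod_map ::
  "('k, 'c) ring_scheme \<Rightarrow> ('k, 'b) bialgebra \<Rightarrow> ('k, 'b') bialgebra \<Rightarrow>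
   ('k, 'e, 'b) comodule_algebra \<Rightarrow> ('k, 'e', 'b') comodule_algebra \<Rightarrow>
   ('e \<Rightarrow> 'e') \<Rightarrow> ('b \<Rightarrow> 'b') \<Rightarrow> bool"
  where "comod_map K B B' E E' f \<phi> \<longleftrightarrow>
    comodule_algebra K B E \<and> comodule_algebra K B' E' \<and>
    \<phi> \<in> alg_hom K B B' \<and> f \<in> comod_alg_hom K B' \<phi> E E'"

lemma comodule_algebraD:
  assumes "comodule_algebra K B E"
  shows "assoc_algebra K B" and "assoc_algebra K E" and "ring B" and "ring E"
proof -
  interpret comodule_algebra K B E by fact
  show "assoc_algebra K B" "assoc_algebra K E" "ring B" "ring E" by unfold_locales
qed

lemma comod_mapD:
  assumes "comod_map K B B' E E' f \<phi>"
  shows "comodule_algebra K B E" and "comodule_algebra K B' E'"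
    and "\<phi> \<in> alg_hom K B B'" and "f \<in> alg_hom K E E'"
    and "e \<in> carrier E \<Longrightarrow> coact E' (f e) =
      tlift (ktensor K E' B') (\<lambda>e0 e1. kpure K E' B' (f e0) (\<phi> e1)) (coact E e)"
    and "f \<in> ring_hom E E'" and "\<phi> \<in> ring_hom B B'"
    and "ring B" and "ring B'" and "ring E" and "ring E'"
  using assms alg_homD(1)[of f K E E'] alg_homD(1)[of \<phi> K B B']
  by (auto simp: comod_map_def comod_alg_hom_def dest: comodule_algebraD)

lemma diagonalI:
  "\<lbrakk>comodule_algebra K B E; left_module E M; left_module B Q\<rbrakk> \<Longrightarrow> diagonal K B E M Q"
  by (simp add: diagonal_def)

lemma comodule_algebra_factors:
  "comodule_algebra K B E \<Longrightarrow> tensor_factors K E (\<lambda>x c. c \<odot>\<^bsub>E\<^esub> x) B"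
  by (intro ktensor_factors assoc_algebra.closed_action_algebra comodule_algebraD)

lemma coact_closed:
  assumes "comodule_algebra K B E" and "e \<in> carrier E"
  shows "coact E e \<in> carrier (ktensor K E B)"
  using comodule_algebra.coact_hom[OF assms(1)] assms(2) ring_hom_closed alg_homD(1) by fastforce

lemma alg_hom_id: "(\<lambda>x. x) \<in> alg_hom K A A"
  by (simp add: alg_hom_def ring_hom_id)

lemma comod_map_id:
  assumes "comodule_algebra K B E"
  shows "comod_map K B B E E (\<lambda>e. e) (\<lambda>b. b)"
  using assms tensor_factors.tlift_pure_self[OF comodule_algebra_factors[OF assms] coact_closed[OF assms]]
  by (simp add: comod_map_def comod_alg_hom_def alg_hom_id)

lemma alg_hom_comp:
  assumes f: "f \<in> alg_hom K A A'" and g: "g \<in> alg_hom K A' A''"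
  shows "g \<circ> f \<in> alg_hom K A A''"
proof -
  note cl = ring_hom_closed[OF alg_homD(1)[OF f]]
  have "g \<circ> f \<in> ring_hom A A''" using ring_hom_trans alg_homD(1)[OF f] alg_homD(1)[OF g] by blast
  then show ?thesis using f g cl by (simp add: alg_hom_def)
qed

text \<open>Colinearity composes because \<open>(g \<otimes> \<phi>') \<circ> (f \<otimes> \<phi>) = (g \<circ> f) \<otimes> (\<phi>' \<circ> \<phi>)\<close>.\<close>

lemma comod_map_comp:
  assumes f: "comod_map K B B' E E' f \<phi>" and g: "comod_map K B' B'' E' E'' g \<phi>'"
  shows "comod_map K B B'' E E'' (g \<circ> f) (\<phi>' \<circ> \<phi>)"
proof -
  note F = comod_mapD[OF f] and G = comod_mapD[OF g]
  interpret EB: tensor_factors K E "\<lambda>x c. c \<odot>\<^bsub>E\<^esub> x" B by (rule comodule_algebra_factors[OF F(1)])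
  interpret EB': tensor_factors K E' "\<lambda>x c. c \<odot>\<^bsub>E'\<^esub> x" B' by (rule comodule_algebra_factors[OF F(2)])
  interpret EB'': tensor_factors K E'' "\<lambda>x c. c \<odot>\<^bsub>E''\<^esub> x" B'' by (rule comodule_algebra_factors[OF G(2)])
  note acted = comodule_algebraD(1,2)[THEN assoc_algebra.closed_action_algebra]
  note bf = ktensor_map_balanced[OF acted(2)[OF F(2)] acted(1)[OF F(2)] alg_homD(2)[OF F(4)] alg_homD(2)[OF F(3)]]
  note bg = ktensor_map_balanced[OF acted(2)[OF G(2)] acted(1)[OF G(2)] alg_homD(2)[OF G(4)] alg_homD(2)[OF G(3)]]
  note clf = ring_hom_closed[OF F(6)] ring_hom_closed[OF F(7)] ring_hom_closed[OF G(6)] ring_hom_closed[OF G(7)]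
  have "coact E'' (g (f e)) =
      tlift EB''.T (\<lambda>e0 e1. EB''.pure (g (f e0)) (\<phi>' (\<phi> e1))) (coact E e)" if e: "e \<in> carrier E" for e
  proof -
    note ce = coact_closed[OF F(1) e]
    have "coact E'' (g (f e)) = tlift EB''.T (\<lambda>e0 e1. EB''.pure (g e0) (\<phi>' e1))
        (tlift EB'.T (\<lambda>e0 e1. EB'.pure (f e0) (\<phi> e1)) (coact E e))"
      using G(5)[OF clf(1)[OF e]] F(5)[OF e] by simp
    also have "\<dots> = tlift EB''.T (\<lambda>e0 e1. tlift EB''.T (\<lambda>e0 e1. EB''.pure (g e0) (\<phi>' e1))
        (EB'.pure (f e0) (\<phi> e1))) (coact E e)"
      by (rule EB.tlift_comp[OF EB'.abelian_group_tensor EB''.abelian_group_tensor bf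
            EB'.tlift_hom[OF EB''.abelian_group_tensor bg] ce])
    also have "\<dots> = tlift EB''.T (\<lambda>e0 e1. EB''.pure (g (f e0)) (\<phi>' (\<phi> e1))) (coact E e)"
      by (rule EB.tlift_cong[OF EB''.abelian_group_tensor ce])
         (simp_all add: clf EB'.tlift_pure[OF EB''.abelian_group_tensor bg])
    finally show ?thesis .
  qed
  then show ?thesis
    using F(1) G(2) alg_hom_comp[OF F(4) G(4)] alg_hom_comp[OF F(3) G(3)]
    by (simp add: comod_map_def comod_alg_hom_def)
qed

text \<open>The map \<open>h \<otimes> k\<close> intertwines the action of \<open>s \<in> E \<otimes> B\<close> with that of \<open>(f \<otimes> \<phi>) s \<in> E' \<otimes> B'\<close>. At
  \<open>s = \<rho> e\<close>, colinearity turns the latter into \<open>\<rho>' (f e)\<close>.\<close>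

lemma mtensor_map:
  assumes fm: "comod_map K B B' E E' f \<phi>"
    and M: "left_module E M" and Q: "left_module B Q"
    and M': "left_module E' M'" and Q': "left_module B' Q'"
    and h: "h \<in> slin E f M M'" and k: "k \<in> slin B \<phi> Q Q'"
  shows mtensor_map_slin: "mtensor_map K B' E' M' Q' h k \<in>
      slin E f (mtensor K B E M Q) (mtensor K B' E' M' Q')"
    and mtensor_map_pure: "\<lbrakk>m \<in> carrier M; q \<in> carrier Q\<rbrakk> \<Longrightarrow>
      mtensor_map K B' E' M' Q' h k (mpure K B E M Q m q) = mpure K B' E' M' Q' (h m) (k q)"
proof -
  note c = comod_mapD[OF fm]
  interpret D: diagonal K B E M Q by (rule diagonalI[OF c(1) M Q])
  interpret D': diagonal K B' E' M' Q' by (rule diagonalI[OF c(2) M' Q'])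
  note alg = comodule_algebraD[OF c(1)] comodule_algebraD[OF c(2)]
  let ?F = "mtensor_map K B' E' M' Q' h k"
  let ?P = "tlift D'.EB.T (\<lambda>e b. D'.EB.pure (f e) (\<phi> b))"
  have F_def: "?F = tlift D'.MQ.T (\<lambda>m q. D'.MQ.pure (h m) (k q))"
    by (simp add: mtensor_map_def tlift_mtensor)
  note agM = D'.MQ.abelian_group_tensor and agE = D'.EB.abelian_group_tensor
  note balF = ktensor_map_balanced[OF D'.actedM D'.actedQ slin_restrict[OF alg(2,6) c(4) h]
      slin_restrict[OF alg(1,5) c(3) k]]
  note balP = ktensor_map_balanced[OF D'.E.closed_action_algebra D'.B.closed_action_algebra
      alg_homD(2)[OF c(4)] alg_homD(2)[OF c(3)]]
  have Fhom: "?F \<in> add_hom D.MQ.T D'.MQ.T" unfolding F_def by (rule D.MQ.tlift_hom[OF agM balF])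
  have Fpure: "?F (D.MQ.pure m q) = D'.MQ.pure (h m) (k q)"
    if "m \<in> carrier M" "q \<in> carrier Q" for m q
    unfolding F_def using D.MQ.tlift_pure[OF agM balF] that by simp
  have Phom: "?P \<in> add_hom D.EB.T D'.EB.T" by (rule D.EB.tlift_hom[OF agE balP])
  note Ppure = D.EB.tlift_pure[OF agE balP]
  note cl = ring_hom_closed[OF c(6)] ring_hom_closed[OF c(7)] slinD(2)[OF h] slinD(2)[OF k]
    add_hom_closed[OF Fhom] add_hom_closed[OF Phom]
    D.M.lsmult_closed D.Q.lsmult_closed
  have act: "?F (D.act s x) = D'.act (?P s) (?F x)" if s: "s \<in> carrier D.EB.T" and x: "x \<in> carrier D.MQ.T" for s x
    using x
  proof (induction rule: D.MQ.tensor_induct)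
    case x: (pure m q)
    from s show ?case
    proof (induction rule: D.EB.tensor_induct)
      case (pure e b)
      then show ?case using x
        by (simp add: D.act_simps D'.act_simps Fpure Ppure cl slinD(3)[OF h] slinD(3)[OF k])
    next
      case (add s s')
      then show ?case using x
        by (simp add: D.act_simps D'.act_simps add_hom_add[OF Phom] add_hom_add[OF Fhom] cl)
    qed
  next
    case (add x x')
    then show ?case using s
      by (simp add: D.act_simps D'.act_simps add_hom_add[OF Fhom] cl)
  qed
  show "?F \<in> slin E f (mtensor K B E M Q) (mtensor K B' E' M' Q')"
    using Fhom by (intro slinI) (simp_all add: act D.coact_closed c(5))
  show "\<lbrakk>m \<in> carrier M; q \<in> carrier Q\<rbrakk> \<Longrightarrow> ?F (D.MQ.pure m q) = D'.MQ.pure (h m) (k q)"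
    by (rule Fpure)
qed

lemma mtensor_map_lmod:
  assumes E: "comodule_algebra K B E"
    and "left_module E M" and "left_module B Q" and "left_module E M'" and "left_module B Q'"
    and "h \<in> lmod_hom E M M'" and "k \<in> lmod_hom B Q Q'"
  shows mtensor_map_hom: "mtensor_map K B E M' Q' h k \<in>
      lmod_hom E (mtensor K B E M Q) (mtensor K B E M' Q')"
    and mtensor_map_hom_pure: "\<lbrakk>m \<in> carrier M; q \<in> carrier Q\<rbrakk> \<Longrightarrow>
      mtensor_map K B E M' Q' h k (mpure K B E M Q m q) = mpure K B E M' Q' (h m) (k q)"
  using mtensor_map[OF comod_map_id[OF E] assms(2-5) assms(6,7)[unfolded lmod_hom_eq_slin]]
  by (simp_all add: lmod_hom_eq_slin)

lemma lmod_iso_inverse: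
  assumes M: "left_module R M" and h: "h \<in> lmod_iso R M N"
  obtains h' where "h' \<in> lmod_hom R N M" and "\<And>m. m \<in> carrier M \<Longrightarrow> h' (h m) = m"
    and "\<And>n. n \<in> carrier N \<Longrightarrow> h (h' n) = n"
proof
  interpret M: left_module R M by (rule M)
  from h have hh: "h \<in> lmod_hom R M N" and b: "bij_betw h (carrier M) (carrier N)"
    by (auto simp: lmod_iso_def)
  let ?h = "inv_into (carrier M) h"
  note hD = lmod_homD[OF hh] add_hom_add[OF lmod_homD(1)[OF hh]]
  show 1: "?h (h m) = m" if "m \<in> carrier M" for m
    using b that by (simp add: bij_betw_inv_into_left)
  show 2: "h (?h n) = n" if "n \<in> carrier N" for n
    using b that by (simp add: bij_betw_inv_into_right)
  have cl: "?h n \<in> carrier M" if "n \<in> carrier N" for n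
    using b that by (metis bij_betw_imp_surj_on inv_into_into)
  show "?h \<in> lmod_hom R N M"
  proof (rule lmod_homI[OF cl])
    show "?h (m \<oplus>\<^bsub>N\<^esub> n) = ?h m \<oplus>\<^bsub>M\<^esub> ?h n" if "m \<in> carrier N" "n \<in> carrier N" for m n
      using 1[of "?h m \<oplus>\<^bsub>M\<^esub> ?h n"] that by (simp add: hD cl 2)
    show "?h (r \<odot>\<^bsub>N\<^esub> m) = r \<odot>\<^bsub>M\<^esub> ?h m" if "r \<in> carrier R" "m \<in> carrier N" for r m
      using 1[of "r \<odot>\<^bsub>M\<^esub> ?h m"] that by (simp add: hD cl 2 M.lsmult_closed)
  qed
qed

lemma mtensor_map_iso:
  assumes E: "comodule_algebra K B E"
    and M: "left_module E M" and Q: "left_module B Q" and M': "left_module E M'" and Q': "left_module B Q'"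
    and h: "h \<in> lmod_iso E M M'" and k: "k \<in> lmod_iso B Q Q'"
  shows "mtensor_map K B E M' Q' h k \<in> lmod_iso E (mtensor K B E M Q) (mtensor K B E M' Q')"
proof -
  interpret D: diagonal K B E M Q by (rule diagonalI[OF E M Q])
  interpret D': diagonal K B E M' Q' by (rule diagonalI[OF E M' Q'])
  from h k have hh: "h \<in> lmod_hom E M M'" and kk: "k \<in> lmod_hom B Q Q'" by (auto simp: lmod_iso_def)
  obtain h' where h': "h' \<in> lmod_hom E M' M" and h1: "\<And>m. m \<in> carrier M \<Longrightarrow> h' (h m) = m"
    and h2: "\<And>n. n \<in> carrier M' \<Longrightarrow> h (h' n) = n" using lmod_iso_inverse[OF M h] by blast
  obtain k' where k': "k' \<in> lmod_hom B Q' Q" and k1: "\<And>m. m \<in> carrier Q \<Longrightarrow> k' (k m) = m"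
    and k2: "\<And>n. n \<in> carrier Q' \<Longrightarrow> k (k' n) = n" using lmod_iso_inverse[OF Q k] by blast
  note F = mtensor_map_lmod[OF E M Q M' Q' hh kk] and G = mtensor_map_lmod[OF E M' Q' M Q h' k']
  let ?F = "mtensor_map K B E M' Q' h k" and ?G = "mtensor_map K B E M Q h' k'"
  note cl = lmod_homD(2)[OF hh] lmod_homD(2)[OF kk] lmod_homD(2)[OF h'] lmod_homD(2)[OF k']
  have GF: "?G (?F t) = t" if "t \<in> carrier (mtensor K B E M Q)" for t
    by (rule D.mtensor_hom_eq[OF lmod_hom_comp[OF F(1) G(1), unfolded lmod_hom_eq_slin]
          lmod_hom_id[unfolded lmod_hom_eq_slin] _ that])
       (simp add: F(2) G(2) cl h1 k1)
  have FG: "?F (?G t) = t" if "t \<in> carrier (mtensor K B E M' Q')" for t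
    by (rule D'.mtensor_hom_eq[OF lmod_hom_comp[OF G(1) F(1), unfolded lmod_hom_eq_slin]
          lmod_hom_id[unfolded lmod_hom_eq_slin] _ that])
       (simp add: F(2) G(2) cl h2 k2)
  have "bij_betw ?F (carrier (mtensor K B E M Q)) (carrier (mtensor K B E M' Q'))"
    by (rule bij_betw_byWitness[where f' = ?G])
       (use GF FG lmod_homD(2)[OF F(1)] lmod_homD(2)[OF G(1)] in auto)
  then show ?thesis using F(1) by (simp add: lmod_iso_def)
qed

section \<open>The 2-cells\<close>

text \<open>The map \<open>\<alpha>\<close> is the linear extension of the tensor product of the units \<open>M \<rightarrow> f\<^sup>* M\<close> and \<open>Q \<rightarrow> \<phi>\<^sup>* Q\<close>,
  which is \<open>f\<close>-semilinear by \<open>mtensor_map\<close>. Comparing with the definition of \<open>\<alpha>\<close> amounts to evaluating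
  \<open>e' \<cdot> ((1 \<otimes> m) \<otimes> (1 \<otimes> q))\<close>.\<close>

lemma alpha:
  assumes fm: "comod_map K B B' E E' f \<phi>" and M: "left_module E M" and Q: "left_module B Q"
  shows alpha_hom: "alpha K B B' E E' f \<phi> M Q \<in>
      lmod_hom E' (ext E f E' (mtensor K B E M Q)) (mtensor K B' E' (ext E f E' M) (ext B \<phi> B' Q))"
    and alpha_unit: "\<lbrakk>m \<in> carrier M; q \<in> carrier Q\<rbrakk> \<Longrightarrow>
      alpha K B B' E E' f \<phi> M Q
        (ext_pure E f E' (mtensor K B E M Q) \<one>\<^bsub>E'\<^esub> (mpure K B E M Q m q)) =
      mpure K B' E' (ext E f E' M) (ext B \<phi> B' Q)
        (ext_pure E f E' M \<one>\<^bsub>E'\<^esub> m) (ext_pure B \<phi> B' Q \<one>\<^bsub>B'\<^esub> q)"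
proof -
  note c = comod_mapD[OF fm]
  interpret D: diagonal K B E M Q by (rule diagonalI[OF c(1) M Q])
  interpret M: scalar_extension E f E' M by (rule scalar_extensionI[OF c(6,11) M])
  interpret Q: scalar_extension B \<phi> B' Q by (rule scalar_extensionI[OF c(7,9) Q])
  interpret D': diagonal K B' E' M.fM Q.fM
    by (rule diagonalI[OF c(2) M.left_module_ext Q.left_module_ext])
  interpret MQ: scalar_extension E f E' "mtensor K B E M Q"
    by (rule scalar_extensionI[OF c(6,11) D.left_module_mtensor])
  let ?T = "mtensor K B' E' M.fM Q.fM" and ?h = "mtensor_map K B' E' M.fM Q.fM M.\<eta> Q.\<eta>"
  note hm = mtensor_map[OF fm M Q M.left_module_ext Q.left_module_ext M.unit_slin Q.unit_slin]
  have h: "?h \<in> slin E ((\<lambda>x. x) \<circ> f) (mtensor K B E M Q) ?T"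
    using hm(1) by (simp add: comp_def)
  note hl = D'.left_module_mtensor ring_hom_id h
  have balh: "balanced K (restrict_base E M) (\<lambda>x c. c \<odot>\<^bsub>restrict_base E M\<^esub> x) (restrict_base B Q)
      D'.MQ.T (\<lambda>m q. D'.MQ.pure (M.\<eta> m) (Q.\<eta> q))"
    by (rule ktensor_map_balanced[OF D'.actedM D'.actedQ
          slin_restrict[OF comodule_algebraD(2)[OF c(1)] comodule_algebraD(2)[OF c(2)] c(4) M.unit_slin]
          slin_restrict[OF comodule_algebraD(1)[OF c(1)] comodule_algebraD(1)[OF c(2)] c(3) Q.unit_slin]])
  have inner: "tlift ?T (\<lambda>m q. tlift ?T (\<lambda>e0 e1. D'.MQ.pure (M.pure e0 m) (Q.pure e1 q)) (coact E' e')) t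
      = e' \<odot>\<^bsub>?T\<^esub> ?h t" if e: "e' \<in> carrier E'" and t: "t \<in> carrier (mtensor K B E M Q)" for e' t
  proof -
    note ce = D'.coact_closed[OF e]
    have t': "t \<in> carrier D.MQ.T" using t by simp
    have "e' \<odot>\<^bsub>?T\<^esub> ?h t = D'.act (coact E' e') (tlift D'.MQ.T (\<lambda>m q. D'.MQ.pure (M.\<eta> m) (Q.\<eta> q)) t)"
      by (simp add: mtensor_map_def tlift_mtensor)
    also have "\<dots> = tlift D'.MQ.T (\<lambda>m q. D'.act (coact E' e') (D'.MQ.pure (M.\<eta> m) (Q.\<eta> q))) t"
      by (rule D.MQ.tlift_comp[OF D'.MQ.abelian_group_tensor D'.MQ.abelian_group_tensor balh
            D'.act_hom_right[OF ce] t'])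
    also have "\<dots> = tlift D'.MQ.T (\<lambda>m q. tlift D'.MQ.T
        (\<lambda>e0 e1. D'.MQ.pure (M.pure e0 m) (Q.pure e1 q)) (coact E' e')) t"
    proof (rule D.MQ.tlift_cong[OF D'.MQ.abelian_group_tensor t'])
      fix m q assume "m \<in> carrier (restrict_base E M)" "q \<in> carrier (restrict_base B Q)"
      then have m: "m \<in> carrier M" and q: "q \<in> carrier Q" by simp_all
      note mc = M.pure_closed[OF M.A'.one_closed m] and qc = Q.pure_closed[OF Q.A'.one_closed q]
      \<comment> \<open>Writing \<open>\<rho> e' = \<Sum> e'\<^sub>0 \<otimes> e'\<^sub>1\<close> and moving the sum out of the action recovers the Sweedler sum.\<close>
      have "D'.act (coact E' e') (D'.MQ.pure (M.\<eta> m) (Q.\<eta> q)) =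
          D'.act (tlift D'.EB.T D'.EB.pure (coact E' e')) (D'.MQ.pure (M.\<eta> m) (Q.\<eta> q))"
        by (simp add: D'.EB.tlift_pure_self[OF ce])
      also have "\<dots> = tlift D'.MQ.T (\<lambda>e0 e1. D'.act (D'.EB.pure e0 e1) (D'.MQ.pure (M.\<eta> m) (Q.\<eta> q))) (coact E' e')"
        by (rule D'.EB.tlift_comp[OF D'.EB.abelian_group_tensor D'.MQ.abelian_group_tensor
              D'.EB.balanced_pure D'.act_hom_left ce]) (use mc qc in simp)
      also have "\<dots> = tlift D'.MQ.T (\<lambda>e0 e1. D'.MQ.pure (M.pure e0 m) (Q.pure e1 q)) (coact E' e')"
        by (rule D'.EB.tlift_cong[OF D'.MQ.abelian_group_tensor ce])
           (use m q mc qc in \<open>simp_all add: D'.act_pure M.smult_pure Q.smult_pure\<close>)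
      finally show "D'.act (coact E' e') (D'.MQ.pure (M.\<eta> m) (Q.\<eta> q)) =
          tlift D'.MQ.T (\<lambda>e0 e1. D'.MQ.pure (M.pure e0 m) (Q.pure e1 q)) (coact E' e')" .
      with add_hom_closed[OF D'.act_hom_right[OF ce], of "D'.MQ.pure (M.\<eta> m) (Q.\<eta> q)"] mc qc
      show "tlift D'.MQ.T (\<lambda>e0 e1. D'.MQ.pure (M.pure e0 m) (Q.pure e1 q)) (coact E' e') \<in> carrier D'.MQ.T"
        by simp
    qed
    finally show ?thesis by (simp add: tlift_mtensor)
  qed
  have eq: "alpha K B B' E E' f \<phi> M Q t = ext_lift (\<lambda>x. x) ?T ?h t" if "t \<in> carrier MQ.fM" for t
    unfolding alpha_def Let_def
    by (rule MQ.tlift_eq_ext_lift[OF hl _ that]) (rule inner)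
  show "alpha K B B' E E' f \<phi> M Q \<in> lmod_hom E' MQ.fM ?T"
    unfolding lmod_hom_eq_slin
    by (rule slin_cong[OF MQ.left_module_ext MQ.ext_lift_slin[OF hl] eq])
  show "alpha K B B' E E' f \<phi> M Q (MQ.\<eta> (D.MQ.pure m q)) = D'.MQ.pure (M.\<eta> m) (Q.\<eta> q)"
    if "m \<in> carrier M" "q \<in> carrier Q"
    using eq[of "MQ.\<eta> (D.MQ.pure m q)"] MQ.ext_lift_unit[OF hl, of "D.MQ.pure m q"] hm(2)[OF that] that
    by simp
qed

lemma scalar_extension2I:
  "\<lbrakk>f \<in> ring_hom A A'; g \<in> ring_hom A' A''; ring A'; ring A''; left_module A M\<rbrakk>
    \<Longrightarrow> scalar_extension2 A f A' M g A''"
  by (intro scalar_extension2.intro scalar_extension2_axioms.intro scalar_extensionI)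

text \<open>The generators on which naturality of \<open>\<alpha>\<close> is tested; the next lemma is the version for the pasting
  identities.\<close>

lemma ext_mtensor_hom_eq:
  assumes fm: "comod_map K B B' E E' f \<phi>" and M: "left_module E M" and Q: "left_module B Q"
    and N: "left_module E' N"
    and u: "u \<in> lmod_hom E' (ext E f E' (mtensor K B E M Q)) N"
    and v: "v \<in> lmod_hom E' (ext E f E' (mtensor K B E M Q)) N"
    and eq: "\<And>m q. \<lbrakk>m \<in> carrier M; q \<in> carrier Q\<rbrakk> \<Longrightarrow>
      u (ext_pure E f E' (mtensor K B E M Q) \<one>\<^bsub>E'\<^esub> (mpure K B E M Q m q)) =
      v (ext_pure E f E' (mtensor K B E M Q) \<one>\<^bsub>E'\<^esub> (mpure K B E M Q m q))"
    and t: "t \<in> carrier (ext E f E' (mtensor K B E M Q))"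
  shows "u t = v t"
proof -
  note c = comod_mapD[OF fm]
  interpret D: diagonal K B E M Q by (rule diagonalI[OF c(1) M Q])
  interpret X: scalar_extension E f E' "mtensor K B E M Q"
    by (rule scalar_extensionI[OF c(6,11) D.left_module_mtensor])
  note uv = u[unfolded lmod_hom_eq_slin] v[unfolded lmod_hom_eq_slin]
  have w: "(\<lambda>x. w (X.\<eta> x)) \<in> slin E f (mtensor K B E M Q) N" if "w \<in> slin E' (\<lambda>r. r) X.fM N" for w
    by (rule slin_comp[OF X.unit_slin that]) (simp_all add: ring_hom_closed[OF c(6)])
  show ?thesis
    by (rule X.ext_hom_eq[OF N uv D.mtensor_hom_eq[OF w[OF uv(1)] w[OF uv(2)] eq] t])
qed

lemma ext_ext_mtensor_hom_eq:
  assumes fm: "comod_map K B B' E E' f \<phi>" and gm: "comod_map K B' B'' E' E'' g \<phi>'"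
    and M: "left_module E M" and Q: "left_module B Q" and N: "left_module E'' N"
    and u: "u \<in> lmod_hom E'' (ext E' g E'' (ext E f E' (mtensor K B E M Q))) N"
    and v: "v \<in> lmod_hom E'' (ext E' g E'' (ext E f E' (mtensor K B E M Q))) N"
    and eq: "\<And>m q. \<lbrakk>m \<in> carrier M; q \<in> carrier Q\<rbrakk> \<Longrightarrow>
      u (ext_pure E' g E'' (ext E f E' (mtensor K B E M Q)) \<one>\<^bsub>E''\<^esub>
          (ext_pure E f E' (mtensor K B E M Q) \<one>\<^bsub>E'\<^esub> (mpure K B E M Q m q))) =
      v (ext_pure E' g E'' (ext E f E' (mtensor K B E M Q)) \<one>\<^bsub>E''\<^esub>
          (ext_pure E f E' (mtensor K B E M Q) \<one>\<^bsub>E'\<^esub> (mpure K B E M Q m q)))"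
    and t: "t \<in> carrier (ext E' g E'' (ext E f E' (mtensor K B E M Q)))"
  shows "u t = v t"
proof -
  note c = comod_mapD[OF fm] and d = comod_mapD[OF gm]
  interpret D: diagonal K B E M Q by (rule diagonalI[OF c(1) M Q])
  interpret X: scalar_extension2 E f E' "mtensor K B E M Q" g E''
    by (rule scalar_extension2I[OF c(6) d(6) c(11) d(11) D.left_module_mtensor])
  note uv = u[unfolded lmod_hom_eq_slin] v[unfolded lmod_hom_eq_slin]
  have w: "(\<lambda>x. w (X.S2.\<eta> (X.S1.\<eta> x))) \<in> slin E (g \<circ> f) (mtensor K B E M Q) N"
    if "w \<in> slin E'' (\<lambda>r. r) X.S2.fM N" for w
    by (rule slin_comp[OF X.unit_unit_slin that]) (simp_all add: ring_hom_closed[OF c(6)] ring_hom_closed[OF d(6)])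
  show ?thesis
    by (rule X.ext_ext_hom_eq[OF N u v D.mtensor_hom_eq[OF w[OF uv(1)] w[OF uv(2)] eq] t])
qed

lemma regular_sel [simp]:
  "carrier (regular_module A) = carrier A" "add (regular_module A) = add A"
  "\<zero>\<^bsub>regular_module A\<^esub> = \<zero>\<^bsub>A\<^esub>" "a \<odot>\<^bsub>regular_module A\<^esub> b = a \<otimes>\<^bsub>A\<^esub> b"
  by (simp_all add: regular_module_def)

lemma left_module_regular:
  assumes "ring A"
  shows "left_module A (regular_module A)"
proof -
  interpret A: ring A by fact
  interpret reg: abelian_group "regular_module A"
    unfolding regular_module_def by (rule abelian_group_as_module) unfold_locales
  show ?thesis
    by unfold_locales (simp_all add: A.l_distr A.r_distr A.m_assoc)
qed

text \<open>The identification \<open>B' \<otimes>\<^sub>B B \<cong> B'\<close> is the linear extension of \<open>\<phi>\<close>, seen as a \<open>\<phi>\<close>-semilinear map of regular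
  modules.\<close>

lemma ext_regular:
  assumes \<phi>: "\<phi> \<in> ring_hom A A'" and A: "ring A" and A': "ring A'"
  shows ext_regular_hom: "ext_regular \<phi> A' \<in> lmod_hom A' (ext A \<phi> A' (regular_module A)) (regular_module A')"
    and ext_regular_unit: "a \<in> carrier A \<Longrightarrow>
      ext_regular \<phi> A' (ext_pure A \<phi> A' (regular_module A) \<one>\<^bsub>A'\<^esub> a) = \<phi> a"
proof -
  interpret X: scalar_extension A \<phi> A' "regular_module A"
    by (rule scalar_extensionI[OF \<phi> A' left_module_regular[OF A]])
  have e: "ext_regular \<phi> A' = ext_lift (\<lambda>x. x) (regular_module A') \<phi>"
    by (simp add: ext_regular_def ext_lift_def tlift_transfer[of "regular_module A'" A'])
  have h: "\<phi> \<in> slin A ((\<lambda>x. x) \<circ> \<phi>) (regular_module A) (regular_module A')"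
    by (intro slinI add_homI)
       (simp_all add: ring_hom_closed[OF \<phi>] ring_hom_add[OF \<phi>] ring_hom_mult[OF \<phi>])
  note hl = left_module_regular[OF A'] ring_hom_id h
  show "ext_regular \<phi> A' \<in> lmod_hom A' X.fM (regular_module A')"
    unfolding e lmod_hom_eq_slin by (rule X.ext_lift_slin[OF hl])
  show "a \<in> carrier A \<Longrightarrow> ext_regular \<phi> A' (X.\<eta> a) = \<phi> a"
    unfolding e using X.ext_lift_unit[OF hl] by simp
qed

lemma alpha_at:
  assumes fm: "comod_map K B B' E E' f \<phi>" and M: "left_module E M"
  shows alpha_at_hom: "alpha_at K B B' E E' f \<phi> M \<in>
      lmod_hom E' (ext E f E' (mtensor K B E M (regular_module B)))
        (mtensor K B' E' (ext E f E' M) (regular_module B'))"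
    and alpha_at_unit: "\<lbrakk>m \<in> carrier M; b \<in> carrier B\<rbrakk> \<Longrightarrow>
      alpha_at K B B' E E' f \<phi> M
        (ext_pure E f E' (mtensor K B E M (regular_module B)) \<one>\<^bsub>E'\<^esub> (mpure K B E M (regular_module B) m b)) =
      mpure K B' E' (ext E f E' M) (regular_module B') (ext_pure E f E' M \<one>\<^bsub>E'\<^esub> m) (\<phi> b)"
proof -
  note c = comod_mapD[OF fm]
  note B = left_module_regular[OF c(8)] and B' = left_module_regular[OF c(9)]
  interpret M: scalar_extension E f E' M by (rule scalar_extensionI[OF c(6,11) M])
  interpret Q: scalar_extension B \<phi> B' "regular_module B" by (rule scalar_extensionI[OF c(7,9) B])
  note a = alpha[OF fm M B]
  note r = ext_regular[OF c(7,8,9)]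
  note mm = mtensor_map_lmod[OF c(2) M.left_module_ext Q.left_module_ext M.left_module_ext B' lmod_hom_id r(1)]
  show "alpha_at K B B' E E' f \<phi> M \<in>
      lmod_hom E' (ext E f E' (mtensor K B E M (regular_module B)))
        (mtensor K B' E' (ext E f E' M) (regular_module B'))"
    using lmod_hom_comp[OF a(1) mm(1)] by (simp add: alpha_at_def comp_def)
  show "\<lbrakk>m \<in> carrier M; b \<in> carrier B\<rbrakk> \<Longrightarrow>
      alpha_at K B B' E E' f \<phi> M
        (ext_pure E f E' (mtensor K B E M (regular_module B)) \<one>\<^bsub>E'\<^esub> (mpure K B E M (regular_module B) m b)) =
      mpure K B' E' (ext E f E' M) (regular_module B') (ext_pure E f E' M \<one>\<^bsub>E'\<^esub> m) (\<phi> b)"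
    by (simp add: alpha_at_def a(2) mm(2) r(2))
qed

section \<open>Functors and natural transformations\<close>

lemma is_mod_functorI:
  fixes F :: "('r, 'm, 's, 'x) mod_functor"
  assumes "\<And>M. left_module R M \<Longrightarrow> left_module S (obj F M)"
    and "\<And>M N h. \<lbrakk>left_module R M; left_module R N; h \<in> lmod_hom R M N\<rbrakk>
      \<Longrightarrow> arr F M N h \<in> lmod_hom S (obj F M) (obj F N)"
    and "\<And>M N h h' x. \<lbrakk>left_module R M; left_module R N; h \<in> lmod_hom R M N; h' \<in> lmod_hom R M N;
        \<And>m. m \<in> carrier M \<Longrightarrow> h m = h' m; x \<in> carrier (obj F M)\<rbrakk>
      \<Longrightarrow> arr F M N h x = arr F M N h' x"
    and "\<And>M x. \<lbrakk>left_module R M; x \<in> carrier (obj F M)\<rbrakk> \<Longrightarrow> arr F M M (\<lambda>m. m) x = x"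
    and "\<And>L M N h k x. \<lbrakk>left_module R L; left_module R M; left_module R N;
        h \<in> lmod_hom R L M; k \<in> lmod_hom R M N; x \<in> carrier (obj F L)\<rbrakk>
      \<Longrightarrow> arr F L N (k \<circ> h) x = arr F M N k (arr F L M h x)"
  shows "is_mod_functor R S F"
  unfolding is_mod_functor_def
proof (intro conjI allI impI ballI)
  fix M N :: "('r, 'm) module" and h h' x
  assume "left_module R M" "left_module R N" "h \<in> lmod_hom R M N" "h' \<in> lmod_hom R M N"
    "\<forall>m \<in> carrier M. h m = h' m" "x \<in> carrier (obj F M)"
  then show "arr F M N h x = arr F M N h' x" by (intro assms(3)) auto
qed (fact assms(1) assms(2) assms(4) assms(5))+

lemma is_mod_functorD:
  assumes "is_mod_functor R S F"
  shows "left_module R M \<Longrightarrow> left_module S (obj F M)"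
    and "\<lbrakk>left_module R M; left_module R N; h \<in> lmod_hom R M N\<rbrakk>
      \<Longrightarrow> arr F M N h \<in> lmod_hom S (obj F M) (obj F N)"
    and "\<lbrakk>left_module R M; left_module R N; h \<in> lmod_hom R M N; h' \<in> lmod_hom R M N;
        \<And>m. m \<in> carrier M \<Longrightarrow> h m = h' m; x \<in> carrier (obj F M)\<rbrakk>
      \<Longrightarrow> arr F M N h x = arr F M N h' x"
    and "\<lbrakk>left_module R M; x \<in> carrier (obj F M)\<rbrakk> \<Longrightarrow> arr F M M (\<lambda>m. m) x = x"
    and "\<lbrakk>left_module R L; left_module R M; left_module R N;
        h \<in> lmod_hom R L M; k \<in> lmod_hom R M N; x \<in> carrier (obj F L)\<rbrakk>
      \<Longrightarrow> arr F L N (k \<circ> h) x = arr F M N k (arr F L M h x)"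
proof -
  note d = assms[unfolded is_mod_functor_def]
  show "left_module R M \<Longrightarrow> left_module S (obj F M)"
    using d[THEN conjunct1] by blast
  show "\<lbrakk>left_module R M; left_module R N; h \<in> lmod_hom R M N\<rbrakk>
      \<Longrightarrow> arr F M N h \<in> lmod_hom S (obj F M) (obj F N)"
    using d[THEN conjunct2, THEN conjunct1] by blast
  show "\<lbrakk>left_module R M; left_module R N; h \<in> lmod_hom R M N; h' \<in> lmod_hom R M N;
        \<And>m. m \<in> carrier M \<Longrightarrow> h m = h' m; x \<in> carrier (obj F M)\<rbrakk>
      \<Longrightarrow> arr F M N h x = arr F M N h' x"
    using d[THEN conjunct2, THEN conjunct2, THEN conjunct1] by blast
  show "\<lbrakk>left_module R M; x \<in> carrier (obj F M)\<rbrakk> \<Longrightarrow> arr F M M (\<lambda>m. m) x = x"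
    using d[THEN conjunct2, THEN conjunct2, THEN conjunct2, THEN conjunct1] by blast
  show "\<lbrakk>left_module R L; left_module R M; left_module R N;
        h \<in> lmod_hom R L M; k \<in> lmod_hom R M N; x \<in> carrier (obj F L)\<rbrakk>
      \<Longrightarrow> arr F L N (k \<circ> h) x = arr F M N k (arr F L M h x)"
    using d[THEN conjunct2, THEN conjunct2, THEN conjunct2, THEN conjunct2] by blast
qed

lemma is_mod_functor_comp:
  fixes F :: "('r, 'm, 's, 'x) mod_functor"
  assumes F: "is_mod_functor R S F" and G: "is_mod_functor S T G"
  shows "is_mod_functor R T (G \<odot>\<^sub>F F)"
proof -
  note f = is_mod_functorD[OF F] and g = is_mod_functorD[OF G]
  show ?thesis
  proof (rule is_mod_functorI, simp_all add: functor_comp_def)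
    fix M :: "('r, 'm) module" assume M: "left_module R M"
    then show "left_module T (obj G (obj F M))" by (intro f g)
    fix x assume x: "x \<in> carrier (obj G (obj F M))"
    have "arr G (obj F M) (obj F M) (arr F M M (\<lambda>m. m)) x = arr G (obj F M) (obj F M) (\<lambda>m. m) x"
      by (rule g(3)[OF f(1)[OF M] f(1)[OF M] f(2)[OF M M lmod_hom_id] lmod_hom_id _ x]) (rule f(4)[OF M])
    then show "arr G (obj F M) (obj F M) (arr F M M (\<lambda>m. m)) x = x" using g(4)[OF f(1)[OF M] x] by simp
  next
    fix M N :: "('r, 'm) module" and h assume "left_module R M" "left_module R N" "h \<in> lmod_hom R M N"
    then show "arr G (obj F M) (obj F N) (arr F M N h) \<in> lmod_hom T (obj G (obj F M)) (obj G (obj F N))"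
      by (intro f g)
  next
    fix M N :: "('r, 'm) module" and h h' x
    assume MN: "left_module R M" "left_module R N" "h \<in> lmod_hom R M N" "h' \<in> lmod_hom R M N"
      and eq: "\<And>m. m \<in> carrier M \<Longrightarrow> h m = h' m" and x: "x \<in> carrier (obj G (obj F M))"
    show "arr G (obj F M) (obj F N) (arr F M N h) x = arr G (obj F M) (obj F N) (arr F M N h') x"
      by (rule g(3)[OF f(1)[OF MN(1)] f(1)[OF MN(2)] f(2)[OF MN(1,2,3)] f(2)[OF MN(1,2,4)] _ x])
         (rule f(3)[OF MN eq])
  next
    fix L M N :: "('r, 'm) module" and h k x
    assume a: "left_module R L" "left_module R M" "left_module R N"
        "h \<in> lmod_hom R L M" "k \<in> lmod_hom R M N" and x: "x \<in> carrier (obj G (obj F L))"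
    note hk = f(2)[OF a(1,2,4)] f(2)[OF a(2,3,5)]
    have "arr G (obj F L) (obj F N) (arr F L N (k \<circ> h)) x =
        arr G (obj F L) (obj F N) (arr F M N k \<circ> arr F L M h) x"
      by (rule g(3)[OF f(1)[OF a(1)] f(1)[OF a(3)] f(2)[OF a(1,3) lmod_hom_o[OF a(4,5)]] lmod_hom_o[OF hk] _ x])
         (simp add: f(5)[OF a])
    also have "\<dots> = arr G (obj F M) (obj F N) (arr F M N k) (arr G (obj F L) (obj F M) (arr F L M h) x)"
      by (rule g(5)[OF f(1)[OF a(1)] f(1)[OF a(2)] f(1)[OF a(3)] hk x])
    finally show "arr G (obj F L) (obj F N) (arr F L N (k \<circ> h)) x =
        arr G (obj F M) (obj F N) (arr F M N k) (arr G (obj F L) (obj F M) (arr F L M h) x)" .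
  qed
qed

lemma is_mod_functor_ext:
  fixes A :: "('a, 'c) ring_scheme"
  assumes f: "f \<in> ring_hom A A'" and A': "ring A'"
  shows "is_mod_functor A A' (ext_functor A f A' :: ('a, 'm, _, _) mod_functor)"
proof -
  note I = scalar_extensionI[OF f A']
  note eq = scalar_extension.ext_hom_eq[OF I, where g = "\<lambda>r. r", folded lmod_hom_eq_slin]
  note mod = scalar_extension.left_module_ext[OF I]
  note map = scalar_extension.ext_map[OF I]
  show ?thesis
  proof (rule is_mod_functorI, simp_all add: ext_functor_def mod map del: ext_sel)
    fix M N :: "('a, 'm) module" and h h' x
    assume a: "left_module A M" "left_module A N" "h \<in> lmod_hom A M N" "h' \<in> lmod_hom A M N"
      "\<And>m. m \<in> carrier M \<Longrightarrow> h m = h' m" and x: "x \<in> carrier (ext A f A' M)"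
    show "ext_map A f A' N h x = ext_map A f A' N h' x"
      by (rule eq[OF a(1) mod[OF a(2)] map(1)[OF a(1,2,3)] map(1)[OF a(1,2,4)] _ x])
         (simp add: map(2)[OF a(1,2,3)] map(2)[OF a(1,2,4)] a(5))
  next
    fix M :: "('a, 'm) module" and x assume M: "left_module A M" and x: "x \<in> carrier (ext A f A' M)"
    show "ext_map A f A' M (\<lambda>m. m) x = x"
      by (rule eq[OF M mod[OF M] map(1)[OF M M lmod_hom_id] lmod_hom_id _ x])
         (simp add: map(2)[OF M M lmod_hom_id])
  next
    fix L M N :: "('a, 'm) module" and h k x
    assume a: "left_module A L" "left_module A M" "left_module A N"
        "h \<in> lmod_hom A L M" "k \<in> lmod_hom A M N" and x: "x \<in> carrier (ext A f A' L)"
    note kh = lmod_hom_o[OF a(4,5)]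
    show "ext_map A f A' N (k \<circ> h) x = ext_map A f A' N k (ext_map A f A' M h x)"
      by (rule eq[OF a(1) mod[OF a(3)] map(1)[OF a(1,3) kh]
            lmod_hom_comp[OF map(1)[OF a(1,2,4)] map(1)[OF a(2,3,5)]] _ x])
         (simp add: map(2)[OF a(1,3) kh] map(2)[OF a(1,2,4)] map(2)[OF a(2,3,5)] lmod_homD(2)[OF a(4)])
  qed
qed

lemma is_mod_functor_G:
  fixes E :: "('k, 'e, 'b) comodule_algebra"
  assumes E: "comodule_algebra K B E"
  shows "is_mod_functor E E (G_functor K B E :: ('e, 'm, _, _) mod_functor)"
proof -
  note B = left_module_regular[OF comodule_algebraD(3)[OF E]]
  note I = diagonalI[OF E _ B]
  note eq = diagonal.mtensor_hom_eq[OF I, where f = "\<lambda>r. r", folded lmod_hom_eq_slin]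
  note mod = diagonal.left_module_mtensor[OF I]
  note map = mtensor_map_lmod[OF E _ B _ B _ lmod_hom_id]
  show ?thesis
  proof (rule is_mod_functorI, simp_all add: G_functor_def mod map del: mtensor_sel)
    fix M N :: "('e, 'm) module" and h h' x
    assume a: "left_module E M" "left_module E N" "h \<in> lmod_hom E M N" "h' \<in> lmod_hom E M N"
      "\<And>m. m \<in> carrier M \<Longrightarrow> h m = h' m" and x: "x \<in> carrier (mtensor K B E M (regular_module B))"
    show "mtensor_map K B E N (regular_module B) h (\<lambda>b. b) x = mtensor_map K B E N (regular_module B) h' (\<lambda>b. b) x"
      by (rule eq[OF a(1) map(1)[OF a(1,2,3)] map(1)[OF a(1,2,4)] _ x])
         (simp add: map(2)[OF a(1,2,3)] map(2)[OF a(1,2,4)] a(5))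
  next
    fix M :: "('e, 'm) module" and x assume M: "left_module E M" and x: "x \<in> carrier (mtensor K B E M (regular_module B))"
    show "mtensor_map K B E M (regular_module B) (\<lambda>m. m) (\<lambda>b. b) x = x"
      by (rule eq[OF M map(1)[OF M M lmod_hom_id] lmod_hom_id _ x])
         (simp add: map(2)[OF M M lmod_hom_id])
  next
    fix L M N :: "('e, 'm) module" and h k x
    assume a: "left_module E L" "left_module E M" "left_module E N"
        "h \<in> lmod_hom E L M" "k \<in> lmod_hom E M N" and x: "x \<in> carrier (mtensor K B E L (regular_module B))"
    note kh = lmod_hom_o[OF a(4,5)]
    show "mtensor_map K B E N (regular_module B) (k \<circ> h) (\<lambda>b. b) x =
        mtensor_map K B E N (regular_module B) k (\<lambda>b. b) (mtensor_map K B E M (regular_module B) h (\<lambda>b. b) x)"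
      by (rule eq[OF a(1) map(1)[OF a(1,3) kh]
            lmod_hom_comp[OF map(1)[OF a(1,2,4)] map(1)[OF a(2,3,5)]] _ x])
         (simp add: map(2)[OF a(1,3) kh] map(2)[OF a(1,2,4)] map(2)[OF a(2,3,5)] lmod_homD(2)[OF a(4)])
  qed
qed

lemma nat_isom_can:
  fixes A :: "('a, 'c) ring_scheme"
  assumes f: "f \<in> ring_hom A A'" and g: "g \<in> ring_hom A' A''" and A': "ring A'" and A'': "ring A''"
  shows "nat_isom A A'' (ext_functor A' g A'' \<odot>\<^sub>F ext_functor A f A') (ext_functor A (g \<circ> f) A'')
    (can A f g A'' :: ('a, 'm, _, _) components)"
proof -
  have I: "scalar_extension2 A f A' M g A''" if "left_module A M" for M
    by (rule scalar_extension2I[OF f g A' A'' that])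
  have nat: "can A f g A'' N (ext_map A' g A'' (ext A f A' N) (ext_map A f A' N h) x) =
      ext_map A (g \<circ> f) A'' N h (can A f g A'' M x)"
    if M: "left_module A M" and N: "left_module A N" and h: "h \<in> lmod_hom A M N"
      and x: "x \<in> carrier (ext A' g A'' (ext A f A' M))" for M N :: "('a, 'm) module" and h x
  proof -
    interpret M: scalar_extension2 A f A' M g A'' by (rule I[OF M])
    interpret N: scalar_extension2 A f A' N g A'' by (rule I[OF N])
    note h1 = M.S1.ext_map[OF N h]
    note h2 = M.S2.ext_map[OF N.S1.left_module_ext h1(1)]
    note h3 = M.S3.ext_map[OF N h]
    show ?thesis
      by (rule M.ext_ext_hom_eq[OF N.S3.left_module_ext lmod_hom_comp[OF h2(1) N.can_hom]
            lmod_hom_comp[OF M.can_hom h3(1)] _ x])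
         (simp add: h1(2) h2(2) h3(2) M.can_unit N.can_unit lmod_homD(2)[OF h] del: o_apply)
  qed
  show ?thesis
    unfolding nat_isom_def nat_transf_def
    by (intro conjI allI impI ballI is_mod_functor_ext[OF ring_hom_trans[OF f g] A'']
          is_mod_functor_comp[OF is_mod_functor_ext[OF f A'] is_mod_functor_ext[OF g A'']])
      (simp_all add: functor_comp_def ext_functor_def scalar_extension2.can_hom[OF I]
        scalar_extension2.can_iso[OF I] nat del: o_apply ext_sel)
qed

lemma nat_transf_alpha_at:
  fixes E :: "('k, 'e, 'b) comodule_algebra"
  assumes fm: "comod_map K B B' E E' f \<phi>"
  shows "nat_transf E E' (ext_functor E f E' \<odot>\<^sub>F G_functor K B E)
    (G_functor K B' E' \<odot>\<^sub>F ext_functor E f E') (alpha_at K B B' E E' f \<phi> :: ('e, 'm, _, _) components)"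
proof -
  note c = comod_mapD[OF fm]
  let ?B = "regular_module B" and ?B' = "regular_module B'"
  note B = left_module_regular[OF c(8)] and B' = left_module_regular[OF c(9)]
  have nat: "alpha_at K B B' E E' f \<phi> N (ext_map E f E' (mtensor K B E N ?B)
        (mtensor_map K B E N ?B h (\<lambda>b. b)) x) =
      mtensor_map K B' E' (ext E f E' N) ?B' (ext_map E f E' N h) (\<lambda>b. b) (alpha_at K B B' E E' f \<phi> M x)"
    if M: "left_module E M" and N: "left_module E N" and h: "h \<in> lmod_hom E M N"
      and x: "x \<in> carrier (ext E f E' (mtensor K B E M ?B))" for M N :: "('e, 'm) module" and h x
  proof -
    interpret M: scalar_extension E f E' M by (rule scalar_extensionI[OF c(6,11) M])
    interpret N: scalar_extension E f E' N by (rule scalar_extensionI[OF c(6,11) N])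
    interpret DM: diagonal K B E M ?B by (rule diagonalI[OF c(1) M B])
    interpret DN: diagonal K B E N ?B by (rule diagonalI[OF c(1) N B])
    interpret DN': diagonal K B' E' N.fM ?B' by (rule diagonalI[OF c(2) N.left_module_ext B'])
    interpret X: scalar_extension E f E' "mtensor K B E M ?B"
      by (rule scalar_extensionI[OF c(6,11) DM.left_module_mtensor])
    note m = mtensor_map_lmod[OF c(1) M B N B h lmod_hom_id]
    note e = X.ext_map[OF DN.left_module_mtensor m(1)]
    note h1 = M.ext_map[OF N h]
    note m' = mtensor_map_lmod[OF c(2) M.left_module_ext B' N.left_module_ext B' h1(1) lmod_hom_id]
    note aM = alpha_at[OF fm M] and aN = alpha_at[OF fm N]
    show ?thesis
      by (rule ext_mtensor_hom_eq[OF fm M B DN'.left_module_mtensor lmod_hom_comp[OF e(1) aN(1)]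
            lmod_hom_comp[OF aM(1) m'(1)] _ x])
         (simp add: e(2) m(2) h1(2) m'(2) aM(2) aN(2) lmod_homD(2)[OF h] ring_hom_closed[OF c(7)])
  qed
  show ?thesis
    unfolding nat_transf_def
    by (intro conjI allI impI ballI
          is_mod_functor_comp[OF is_mod_functor_G[OF c(1)] is_mod_functor_ext[OF c(6,11)]]
          is_mod_functor_comp[OF is_mod_functor_ext[OF c(6,11)] is_mod_functor_G[OF c(2)]])
      (simp_all add: functor_comp_def ext_functor_def G_functor_def alpha_at(1)[OF fm] nat
        del: ext_sel mtensor_sel)
qed

section \<open>Pasting\<close>

text \<open>Along the left-hand side, \<open>1 \<otimes> (1 \<otimes> (m \<otimes> q))\<close> becomes \<open>1 \<otimes> ((1 \<otimes> m) \<otimes> (1 \<otimes> q))\<close>, then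
  \<open>(1 \<otimes> (1 \<otimes> m)) \<otimes> (1 \<otimes> (1 \<otimes> q))\<close> and finally \<open>(1 \<otimes> m) \<otimes> (1 \<otimes> q)\<close>; along the right-hand side it becomes
  \<open>1 \<otimes> (m \<otimes> q)\<close> and then the same.\<close>

lemma alpha_paste:
  assumes fm: "comod_map K B B' E E' f \<phi>" and gm: "comod_map K B' B'' E' E'' g \<phi>'"
    and M: "left_module E M" and Q: "left_module B Q"
    and t: "t \<in> carrier (ext E' g E'' (ext E f E' (mtensor K B E M Q)))"
  shows "mtensor_map K B'' E'' (ext E (g \<circ> f) E'' M) (ext B (\<phi>' \<circ> \<phi>) B'' Q)
             (can E f g E'' M) (can B \<phi> \<phi>' B'' Q)
           (alpha K B' B'' E' E'' g \<phi>' (ext E f E' M) (ext B \<phi> B' Q)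
             (ext_map E' g E'' (mtensor K B' E' (ext E f E' M) (ext B \<phi> B' Q))
               (alpha K B B' E E' f \<phi> M Q) t)) =
         alpha K B B'' E E'' (g \<circ> f) (\<phi>' \<circ> \<phi>) M Q (can E f g E'' (mtensor K B E M Q) t)"
proof -
  note c = comod_mapD[OF fm] and d = comod_mapD[OF gm] and gfm = comod_map_comp[OF fm gm]
  interpret D: diagonal K B E M Q by (rule diagonalI[OF c(1) M Q])
  interpret MM: scalar_extension2 E f E' M g E'' by (rule scalar_extension2I[OF c(6) d(6) c(11) d(11) M])
  interpret QQ: scalar_extension2 B \<phi> B' Q \<phi>' B'' by (rule scalar_extension2I[OF c(7) d(7) c(9) d(9) Q])
  interpret X: scalar_extension2 E f E' "mtensor K B E M Q" g E''
    by (rule scalar_extension2I[OF c(6) d(6) c(11) d(11) D.left_module_mtensor])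
  note M1 = MM.S1.left_module_ext and Q1 = QQ.S1.left_module_ext
  note M2 = MM.S2.left_module_ext and Q2 = QQ.S2.left_module_ext
  note M3 = MM.S3.left_module_ext and Q3 = QQ.S3.left_module_ext
  interpret D1: diagonal K B' E' MM.S1.fM QQ.S1.fM by (rule diagonalI[OF c(2) M1 Q1])
  interpret D3: diagonal K B'' E'' MM.S3.fM QQ.S3.fM by (rule diagonalI[OF d(2) M3 Q3])
  note a1 = alpha[OF fm M Q] and a2 = alpha[OF gm M1 Q1] and a3 = alpha[OF gfm M Q]
  note cc = mtensor_map_lmod[OF d(2) M2 Q2 M3 Q3 MM.can_hom QQ.can_hom]
  note em = X.S2.ext_map[OF D1.left_module_mtensor a1(1)]
  show ?thesis
    by (rule ext_ext_mtensor_hom_eq[OF fm gm M Q D3.left_module_mtensor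
          lmod_hom_comp[OF lmod_hom_comp[OF em(1) a2(1)] cc(1)] lmod_hom_comp[OF X.can_hom a3(1)] _ t])
       (simp add: em(2) a1(2) a2(2) a3(2) cc(2) X.can_unit MM.can_unit QQ.can_unit del: o_apply)
qed

lemma alpha_at_paste:
  assumes fm: "comod_map K B B' E E' f \<phi>" and gm: "comod_map K B' B'' E' E'' g \<phi>'"
    and M: "left_module E M"
    and t: "t \<in> carrier (ext E' g E'' (ext E f E' (mtensor K B E M (regular_module B))))"
  shows "mtensor_map K B'' E'' (ext E (g \<circ> f) E'' M) (regular_module B'') (can E f g E'' M) (\<lambda>b. b)
           (alpha_at K B' B'' E' E'' g \<phi>' (ext E f E' M)
             (ext_map E' g E'' (mtensor K B' E' (ext E f E' M) (regular_module B'))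
               (alpha_at K B B' E E' f \<phi> M) t)) =
         alpha_at K B B'' E E'' (g \<circ> f) (\<phi>' \<circ> \<phi>) M (can E f g E'' (mtensor K B E M (regular_module B)) t)"
proof -
  note c = comod_mapD[OF fm] and d = comod_mapD[OF gm] and gfm = comod_map_comp[OF fm gm]
  note B = left_module_regular[OF c(8)] and B' = left_module_regular[OF c(9)]
    and B'' = left_module_regular[OF d(9)]
  interpret D: diagonal K B E M "regular_module B" by (rule diagonalI[OF c(1) M B])
  interpret MM: scalar_extension2 E f E' M g E'' by (rule scalar_extension2I[OF c(6) d(6) c(11) d(11) M])
  interpret X: scalar_extension2 E f E' "mtensor K B E M (regular_module B)" g E''
    by (rule scalar_extension2I[OF c(6) d(6) c(11) d(11) D.left_module_mtensor])
  note M1 = MM.S1.left_module_ext and M2 = MM.S2.left_module_ext and M3 = MM.S3.left_module_ext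
  interpret D1: diagonal K B' E' MM.S1.fM "regular_module B'" by (rule diagonalI[OF c(2) M1 B'])
  interpret D3: diagonal K B'' E'' MM.S3.fM "regular_module B''" by (rule diagonalI[OF d(2) M3 B''])
  note a1 = alpha_at[OF fm M] and a2 = alpha_at[OF gm M1] and a3 = alpha_at[OF gfm M]
  note cc = mtensor_map_lmod[OF d(2) M2 B'' M3 B'' MM.can_hom lmod_hom_id]
  note em = X.S2.ext_map[OF D1.left_module_mtensor a1(1)]
  have a3': "alpha_at K B B'' E E'' (g \<circ> f) (\<phi>' \<circ> \<phi>) M (X.S3.\<eta> (D.MQ.pure m b)) =
      D3.MQ.pure (MM.S3.\<eta> m) (\<phi>' (\<phi> b))" if "m \<in> carrier M" "b \<in> carrier B" for m b
    using a3(2)[OF that] by (simp only: o_apply)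
  show ?thesis
    by (rule ext_ext_mtensor_hom_eq[OF fm gm M B D3.left_module_mtensor
          lmod_hom_comp[OF lmod_hom_comp[OF em(1) a2(1)] cc(1)] lmod_hom_comp[OF X.can_hom a3(1)] _ t])
       (simp add: em(2) a1(2) a2(2) a3' cc(2) X.can_unit MM.can_unit ring_hom_closed[OF c(7)]
         ring_hom_closed[OF d(7)] del: o_apply)
qed

theorem mainTheorem3:
  fixes K :: "'k ring"
    and B :: "('k, 'b) bialgebra" and B' :: "('k, 'b1) bialgebra" and B'' :: "('k, 'b2) bialgebra"
    and E :: "('k, 'e, 'b) comodule_algebra" and E' :: "('k, 'e1, 'b1) comodule_algebra"
    and E'' :: "('k, 'e2, 'b2) comodule_algebra"
    and \<phi> :: "'b \<Rightarrow> 'b1" and \<phi>' :: "'b1 \<Rightarrow> 'b2" and f :: "'e \<Rightarrow> 'e1" and g :: "'e1 \<Rightarrow> 'e2"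
  assumes "field K"
    and "bialgebra K B" and "bialgebra K B'" and "bialgebra K B''"
    and "\<phi> \<in> bialg_hom K B B'" and "\<phi>' \<in> bialg_hom K B' B''"
    and "comodule_algebra K B E" and "comodule_algebra K B' E'" and "comodule_algebra K B'' E''"
    and "f \<in> comod_alg_hom K B' \<phi> E E'" and "g \<in> comod_alg_hom K B'' \<phi>' E' E''"
  shows
    \<comment> \<open>the canonical isomorphisms\<close>
    "nat_isom E E''
       (ext_functor E' g E'' \<odot>\<^sub>F ext_functor E f E') (ext_functor E (g \<circ> f) E'')
       (can E f g E'' :: ('e, 'x, _, _) components) \<and>
     nat_isom B B''
       (ext_functor B' \<phi>' B'' \<odot>\<^sub>F ext_functor B \<phi> B') (ext_functor B (\<phi>' \<circ> \<phi>) B'')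
       (can B \<phi> \<phi>' B'' :: ('b, 'y, _, _) components) \<and>
     \<comment> \<open>the pasting identity for all modules\<close>
     (\<forall>(M :: ('e, 'm) module) (Q :: ('b, 'q) module). left_module E M \<longrightarrow> left_module B Q \<longrightarrow>
       alpha K B B' E E' f \<phi> M Q \<in>
         lmod_hom E' (ext E f E' (mtensor K B E M Q))
                     (mtensor K B' E' (ext E f E' M) (ext B \<phi> B' Q)) \<and>
       alpha K B' B'' E' E'' g \<phi>' (ext E f E' M) (ext B \<phi> B' Q) \<in>
         lmod_hom E'' (ext E' g E'' (mtensor K B' E' (ext E f E' M) (ext B \<phi> B' Q)))
                      (mtensor K B'' E'' (ext E' g E'' (ext E f E' M)) (ext B' \<phi>' B'' (ext B \<phi> B' Q))) \<and>
       alpha K B B'' E E'' (g \<circ> f) (\<phi>' \<circ> \<phi>) M Q \<in>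
         lmod_hom E'' (ext E (g \<circ> f) E'' (mtensor K B E M Q))
                      (mtensor K B'' E'' (ext E (g \<circ> f) E'' M) (ext B (\<phi>' \<circ> \<phi>) B'' Q)) \<and>
       mtensor_map K B'' E'' (ext E (g \<circ> f) E'' M) (ext B (\<phi>' \<circ> \<phi>) B'' Q)
           (can E f g E'' M) (can B \<phi> \<phi>' B'' Q) \<in>
         lmod_iso E'' (mtensor K B'' E'' (ext E' g E'' (ext E f E' M)) (ext B' \<phi>' B'' (ext B \<phi> B' Q)))
                      (mtensor K B'' E'' (ext E (g \<circ> f) E'' M) (ext B (\<phi>' \<circ> \<phi>) B'' Q)) \<and>
       (\<forall>t \<in> carrier (ext E' g E'' (ext E f E' (mtensor K B E M Q))).
         mtensor_map K B'' E'' (ext E (g \<circ> f) E'' M) (ext B (\<phi>' \<circ> \<phi>) B'' Q)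
             (can E f g E'' M) (can B \<phi> \<phi>' B'' Q)
           (alpha K B' B'' E' E'' g \<phi>' (ext E f E' M) (ext B \<phi> B' Q)
             (ext_map E' g E'' (mtensor K B' E' (ext E f E' M) (ext B \<phi> B' Q))
               (alpha K B B' E E' f \<phi> M Q) t)) =
         alpha K B B'' E E'' (g \<circ> f) (\<phi>' \<circ> \<phi>) M Q (can E f g E'' (mtensor K B E M Q) t))) \<and>
     \<comment> \<open>the components at the bialgebras as natural transformations\<close>
     nat_transf E E'
       (ext_functor E f E' \<odot>\<^sub>F G_functor K B E) (G_functor K B' E' \<odot>\<^sub>F ext_functor E f E')
       (alpha_at K B B' E E' f \<phi> :: ('e, 'm, _, _) components) \<and>
     nat_transf E' E''
       (ext_functor E' g E'' \<odot>\<^sub>F G_functor K B' E') (G_functor K B'' E'' \<odot>\<^sub>F ext_functor E' g E'')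
       (alpha_at K B' B'' E' E'' g \<phi>' :: ('e1, 'n, _, _) components) \<and>
     nat_transf E E''
       (ext_functor E (g \<circ> f) E'' \<odot>\<^sub>F G_functor K B E) (G_functor K B'' E'' \<odot>\<^sub>F ext_functor E (g \<circ> f) E'')
       (alpha_at K B B'' E E'' (g \<circ> f) (\<phi>' \<circ> \<phi>) :: ('e, 'm, _, _) components) \<and>
     \<comment> \<open>their pasting identity\<close>
     (\<forall>M :: ('e, 'm) module. left_module E M \<longrightarrow>
       (\<forall>t \<in> carrier (ext E' g E'' (ext E f E' (obj (G_functor K B E) M))).
         mtensor_map K B'' E'' (ext E (g \<circ> f) E'' M) (regular_module B'') (can E f g E'' M) (\<lambda>b. b)
           (vert_comp
              (whisker_right (alpha_at K B' B'' E' E'' g \<phi>') (ext_functor E f E'))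
              (ext_whisker E' g E'' (G_functor K B' E' \<odot>\<^sub>F ext_functor E f E')
                 (alpha_at K B B' E E' f \<phi>)) M t) =
         alpha_at K B B'' E E'' (g \<circ> f) (\<phi>' \<circ> \<phi>) M (can E f g E'' (obj (G_functor K B E) M) t)))"
proof -
  have fm: "comod_map K B B' E E' f \<phi>" and gm: "comod_map K B' B'' E' E'' g \<phi>'"
    using assms by (auto simp: comod_map_def bialg_hom_def)
  note gfm = comod_map_comp[OF fm gm]
  note c = comod_mapD[OF fm] and d = comod_mapD[OF gm]
  show ?thesis
  proof (intro conjI allI impI ballI, goal_cases)
    case 1
    show ?case by (rule nat_isom_can[OF c(6) d(6) c(11) d(11)])
  next
    case 2
    show ?case by (rule nat_isom_can[OF c(7) d(7) c(9) d(9)])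
  next
    case (3 M Q)
    then show ?case by (rule alpha_hom[OF fm])
  next
    case (4 M Q)
    then show ?case
      by (intro alpha_hom[OF gm] scalar_extension.left_module_ext[OF scalar_extensionI] c)
  next
    case (5 M Q)
    then show ?case by (rule alpha_hom[OF gfm])
  next
    case (6 M Q)
    interpret M: scalar_extension2 E f E' M g E''
      by (rule scalar_extension2I[OF c(6) d(6) c(11) d(11) 6(1)])
    interpret Q: scalar_extension2 B \<phi> B' Q \<phi>' B''
      by (rule scalar_extension2I[OF c(7) d(7) c(9) d(9) 6(2)])
    show ?case
      by (rule mtensor_map_iso[OF d(2) M.S2.left_module_ext Q.S2.left_module_ext
            M.S3.left_module_ext Q.S3.left_module_ext M.can_iso Q.can_iso])
  next
    case (7 M Q t)
    then show ?case by (rule alpha_paste[OF fm gm])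
  next
    case 8
    show ?case by (rule nat_transf_alpha_at[OF fm])
  next
    case 9
    show ?case by (rule nat_transf_alpha_at[OF gm])
  next
    case 10
    show ?case by (rule nat_transf_alpha_at[OF gfm])
  next
    case (11 M t)
    then show ?case
      using alpha_at_paste[OF fm gm]
      by (simp add: vert_comp_def whisker_right_def ext_whisker_def functor_comp_def
          ext_functor_def G_functor_def del: ext_sel)
  qed
qed

end
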